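(* Let $m\ge1$ and let $P$ be a naturally labeled poset on $\{1,2,\dots,m\}$. Let $b_1\le b_2\le\dots\le b_m$ be the increasing rearrangement of $\mathrm{mc}_P(1),\mathrm{mc}_P(2),\dots,\mathrm{mc}_P(m)$. Then the Newton polygon of $$F_P(q,x)=[m]_q!\,E_{\overline{P}}(x)=\sum_{\pi\in\mathcal{L}(P)} q^{\mathrm{maj}(\pi)}\prod_{i=1}^m\left([i-\mathrm{des}(\pi)]_q+q^{i-\mathrm{des}(\pi)}x\right)$$ is given by $$\mathrm{Newton}(F_P(q,x))=C\left(b_1,\dots,b_m;\binom{m+1}{2}\right).$$
   Context: For $n\in\mathbb{Z}$, $[n]_q=\frac{1-q^n}{1-q}$ (so $[-n]_q=-q^{-n}[n]_q$), and $[m]_q!=[1]_q[2]_q\cdots[m]_q$. A poset $P$ on $\{1,\dots,m\}$ is naturally labeled if $x\le_P y$ implies $x\le y$. A linear extension of $P$ is a permutation $\pi=\pi_1\dots\pi_m$ of $\{1,\dots,m\}$ such that $\pi_i\le_P\pi_j$ implies $i\le j$; $\mathcal{L}(P)$ is the set of linear extensions. A descent of $\pi$ is an integer $1\le i\le m-1$ with $\pi_i>\pi_{i+1}$; $\mathrm{des}(\pi)$ is the number of descents and $\mathrm{maj}(\pi)$ is the sum of all descents. $F_P(q,x)$ is defined by the sum over $\mathcal{L}(P)$ displayed in the claim; it is a polynomial in $\mathbb{Z}[q,x]$. $\overline{P}$ is the dual poset of $P$ ($x\le_P y$ iff $y\le_{\overline{P}}x$). For a poset $Q$ on $\{1,\dots,m\}$,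 $E_Q(x)\in\mathbb{Q}(q)[x]$ is the $q$-Ehrhart polynomial of the order polytope $\mathcal{O}(Q)=\{(x_1,\dots,x_m)\in[0,1]^m:x_i\le x_j\text{ if } i\le_Q j\}$, i.e. the unique polynomial in $x$ such that $E_Q([n]_q)=\sum_{\mathbf{x}\in n\mathcal{O}(Q)\cap\mathbb{Z}^m}q^{x_1+\dots+x_m}$ for every integer $n\ge0$ (it exists by a theorem of Chapoton). For $x\in P$, $\mathrm{mc}_P(x)$ is the maximum size (number of elements) of a chain $\{t_1<_P\dots<_P t_k\}$ in $P$ ending at $x$, i.e. with $t_k=x$. $\mathrm{Newton}(f(q,x))$ is the convex hull in $\mathbb{R}^2$ of the points $(i,j)$ such that the coefficient of $q^ix^j$ in $f$ is nonzero. For integers $1\le a_1\le\dots\le a_m$ and $h\ge a_1+\dots+a_m$, $C(a_1,\dots,a_m;h)$ is the convex hull in $\mathbb{R}^2$ of the points $(0,0)$, $(a_1+\dots+a_i,i)$ for $1\le i\le m$, $(h,m)$ and $(h-m,0)$. *)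

theory Defs
  imports
    "HOL-Analysis.Analysis"
    "HOL-Combinatorics.Permutations"
    "HOL-Computational_Algebra.Computational_Algebra"
begin

type_synonym ratfun = "rat poly fract"  (* the field of rational functions in q over the rationals *)

definition qvar :: ratfun where
  "qvar = to_fract [:0, 1:]"

definition qint :: "int \<Rightarrow> ratfun" where
  "qint n = (1 - qvar powi n) / (1 - qvar)"

definition qfact :: "nat \<Rightarrow> ratfun" where
  "qfact m = (\<Prod>k = 1..m. qint (int k))"

definition naturally_labeled_poset :: "nat \<Rightarrow> nat rel \<Rightarrow> bool" where
  "naturally_labeled_poset m P \<longleftrightarrow>
     partial_order_on {1..m} P \<and> (\<forall>x y. (x, y) \<in> P \<longrightarrow> x \<le> y)"

(* The word pi_1 ... pi_m is the function i |-> pi_i; "permutes" makes it the identity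
   outside {1..m}, so every permutation is represented exactly once. *)
definition linear_extensions :: "nat \<Rightarrow> nat rel \<Rightarrow> (nat \<Rightarrow> nat) set" where
  "linear_extensions m P =
     {\<pi>. \<pi> permutes {1..m} \<and>
         (\<forall>i\<in>{1..m}. \<forall>j\<in>{1..m}. (\<pi> i, \<pi> j) \<in> P \<longrightarrow> i \<le> j)}"

definition descents :: "nat \<Rightarrow> (nat \<Rightarrow> nat) \<Rightarrow> nat set" where
  "descents m \<pi> = {i. 1 \<le> i \<and> i < m \<and> \<pi> i > \<pi> (i + 1)}"

definition des :: "nat \<Rightarrow> (nat \<Rightarrow> nat) \<Rightarrow> nat" where
  "des m \<pi> = card (descents m \<pi>)"

definition maj :: "nat \<Rightarrow> (nat \<Rightarrow> nat) \<Rightarrow> nat" where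
  "maj m \<pi> = \<Sum>(descents m \<pi>)"

(* The sum is formed over the rational functions in q, because single factors may
   contain negative powers of q. The outer polynomial variable is x. *)
definition F_sum :: "nat \<Rightarrow> nat rel \<Rightarrow> ratfun poly" where
  "F_sum m P =
     (\<Sum>\<pi>\<in>linear_extensions m P.
        smult (qvar ^ maj m \<pi>)
          (\<Prod>i = 1..m. [: qint (int i - int (des m \<pi>)), qvar powi (int i - int (des m \<pi>)) :]))"

(* Integer polynomials in q and x have type int poly poly: the outer variable is x, the inner
   one is q, so the coefficient of q^i x^j in f is coeff (coeff f j) i. *)
definition embed_qx :: "int poly poly \<Rightarrow> ratfun poly" where
  "embed_qx f = map_poly (\<lambda>c. to_fract (map_poly rat_of_int c)) f"

definition F_poly :: "nat \<Rightarrow> nat rel \<Rightarrow> int poly poly" where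
  "F_poly m P = (THE f. embed_qx f = F_sum m P)"

(* Points of R^m are functions on {1..m}, extended by "undefined" elsewhere. *)
definition order_polytope :: "nat \<Rightarrow> nat rel \<Rightarrow> (nat \<Rightarrow> real) set" where
  "order_polytope m Q =
     {x \<in> {1..m} \<rightarrow>\<^sub>E {0..1}. \<forall>i j. (i, j) \<in> Q \<longrightarrow> x i \<le> x j}"

definition dilate :: "nat \<Rightarrow> nat \<Rightarrow> (nat \<Rightarrow> real) set \<Rightarrow> (nat \<Rightarrow> real) set" where
  "dilate m n S = (\<lambda>x. \<lambda>i\<in>{1..m}. real n * x i) ` S"

definition lattice_points :: "nat \<Rightarrow> (nat \<Rightarrow> real) set \<Rightarrow> (nat \<Rightarrow> int) set" where
  "lattice_points m S =
     {z \<in> {1..m} \<rightarrow>\<^sub>E UNIV. (\<lambda>i\<in>{1..m}. real_of_int (z i)) \<in> S}"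

definition q_Ehrhart :: "nat \<Rightarrow> nat rel \<Rightarrow> ratfun poly" where
  "q_Ehrhart m Q =
     (THE E. \<forall>n. poly E (qint (int n)) =
        (\<Sum>z\<in>lattice_points m (dilate m n (order_polytope m Q)). qvar powi (\<Sum>i = 1..m. z i)))"

definition mc :: "nat rel \<Rightarrow> nat \<Rightarrow> nat" where
  "mc P x = Max {card T | T. T \<in> Chains P \<and> x \<in> T \<and> (\<forall>t\<in>T. (t, x) \<in> P)}"

definition newton_polygon :: "'a::zero poly poly \<Rightarrow> (real \<times> real) set" where
  "newton_polygon f = convex hull {(real i, real j) | i j. coeff (coeff f j) i \<noteq> 0}"

(* a = [a_1, ..., a_m] *)
definition C_polygon :: "nat list \<Rightarrow> nat \<Rightarrow> (real \<times> real) set" where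
  "C_polygon a h = (let m = length a in
     convex hull ({(0, 0), (real h, real m), (real h - real m, 0)} \<union>
                  {(real (sum_list (take i a)), real i) | i. 1 \<le> i \<and> i \<le> m}))"

end

(* Proof idea. Sorting the elements by decreasing value, ties by increasing label, decomposes the
   order-reversing maps z : P -> {0..n} according to linear extensions; this evaluates F_P at
   x = [n]_q and gives the q-Ehrhart identity.

   For the left edge, put y = q^n = 1 - (1 - q) [n]_q. A sign-reversing involution shows
     sum_z q^|z| = sum_I (-1)^|I| y^|I| S_I(q)
   over order ideals I, where S_I counts the maps P -> N that are positive and strictly increasing
   on I and weakly decreasing off I. The S_I have nonnegative coefficients, so nothing cancels
   between ideals of equal size j, and the lowest exponent occurring is the minimum of
   sum_{x in I} mc_P(x), i.e. b_1 + ... + b_j. Since b_1 + ... + b_j is strictly increasing in j,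
   expanding y in powers of x does not change the lowest term of the coefficient of x^j.

   For the right edge, the summand of a linear extension with d descents satisfies
   deg_q <= binom(m+1, 2) - m - d + deg_x, so only d = 0 reaches the edge. *)

theory Submission
  imports Defs
begin

section \<open>Weakly decreasing sequences with prescribed strict steps\<close>

text \<open>The left edge cannot be read off the defining sum. Once the negative powers of q are
  cleared, a summand with d >= 2 descents contains factors x - [k], so its coefficients have both
  signs and linear extensions interfere. In the expansion over ideals the only sign is (-1)^j, the
  same for all ideals of size j, and the leading coefficient (q - 1)^j of y^j as a polynomial in x
  absorbs it.

  The S_I are infinite series because the maps are unbounded. That identity therefore lives in
  polynomials in x over \<open>int fps\<close>, where the prefactor [1]...[m] has constant term 1
  and leaves lowest terms alone. The claim itself concerns \<open>int poly\<close> and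
  \<open>ratfun\<close>, so \<open>qnum\<close> is a sum and not a quotient: one polynomial
  \<open>F_gen\<close> then makes sense over all three rings. The bridge between polynomials in x
  and counting is evaluation at x = [n] for every n, infinitely many points of an integral
  domain.\<close>

definition qnum :: "'a::comm_ring_1 \<Rightarrow> nat \<Rightarrow> 'a" where
  "qnum q n = (\<Sum>i<n. q ^ i)"

lemma qnum_0 [simp]: "qnum q 0 = 0"
  by (simp add: qnum_def)

lemma qnum_Suc: "qnum q (Suc n) = qnum q n + q ^ n"
  by (simp add: qnum_def)

lemma qnum_add: "qnum q (a + b) = qnum q a + q ^ a * qnum q b"
  by (induction b) (simp_all add: qnum_Suc algebra_simps power_add)

text \<open>If \<open>D\<close> is the descent set of a linear extension \<pi>, these are the words
  z(\<pi>_1), ..., z(\<pi>_m) of the maps z that sort to \<pi>: equal neighbours are allowed only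
  where the labels ascend.\<close>

definition weak_seqs :: "nat set \<Rightarrow> nat \<Rightarrow> nat \<Rightarrow> (nat \<Rightarrow> nat) set" where
  "weak_seqs D m n =
     {y \<in> {1..m} \<rightarrow>\<^sub>E {..n}. \<forall>i. 1 \<le> i \<and> i < m \<longrightarrow> y (Suc i) + of_bool (i \<in> D) \<le> y i}"

definition weak_sum :: "nat set \<Rightarrow> nat \<Rightarrow> 'a::comm_ring_1 \<Rightarrow> nat \<Rightarrow> 'a" where
  "weak_sum D m q n = (\<Sum>y\<in>weak_seqs D m n. q ^ (\<Sum>i = 1..m. y i))"

lemma finite_weak_seqs: "finite (weak_seqs D m n)"
  by (rule finite_subset[of _ "{1..m} \<rightarrow>\<^sub>E {..n}"]) (auto simp: weak_seqs_def finite_PiE)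

lemma weak_seqs_decreasing:
  assumes "y \<in> weak_seqs D m n" "1 \<le> i" "i \<le> j" "j \<le> m"
  shows "y j \<le> y i"
  using assms(3,4)
proof (induction j rule: dec_induct)
  case (step k)
  have "y (Suc k) + of_bool (k \<in> D) \<le> y k"
    using assms(1,2) step by (auto simp: weak_seqs_def)
  then show ?case using step by simp
qed simp

text \<open>The last entry is the smallest, so all entries are positive. Subtracting 1 from each
  keeps every step and lowers the sum by \<open>m\<close>.\<close>

lemma weak_sum_pos_last:
  assumes "1 \<le> m"
  shows "(\<Sum>y | y \<in> weak_seqs D m n \<and> 1 \<le> y m. q ^ (\<Sum>i = 1..m. y i)) =
         (if n = 0 then 0 else q ^ m * weak_sum D m q (n - 1))"
proof (cases n)
  case 0
  have no: "\<not> (y \<in> weak_seqs D m n \<and> 1 \<le> y m)" for y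
    using assms 0 by (fastforce simp: weak_seqs_def PiE_def Pi_def)
  have "{y. y \<in> weak_seqs D m n \<and> 1 \<le> y m} = {}"
    using no by blast
  then have "(\<Sum>y | y \<in> weak_seqs D m n \<and> 1 \<le> y m. q ^ (\<Sum>i = 1..m. y i)) = 0"
    by (simp only: sum.empty)
  then show ?thesis using 0 by simp
next
  case (Suc k)
  have pos: "1 \<le> y i" if "y \<in> weak_seqs D m n" "1 \<le> y m" "i \<in> {1..m}" for y i
    using weak_seqs_decreasing[OF that(1), of i m] that by auto
  have sum_shift: "(\<Sum>i = 1..m. y i) = m + (\<Sum>i = 1..m. y i - 1)"
    if "y \<in> weak_seqs D m n" "1 \<le> y m" for y
  proof -
    have "(\<Sum>i = 1..m. y i) = (\<Sum>i = 1..m. 1 + (y i - 1))"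
      using pos[OF that] by (intro sum.cong) fastforce+
    also have "\<dots> = m + (\<Sum>i = 1..m. y i - 1)"
      by (subst sum.distrib) simp
    finally show ?thesis .
  qed
  have "(\<Sum>y | y \<in> weak_seqs D m n \<and> 1 \<le> y m. q ^ (\<Sum>i = 1..m. y i)) =
        (\<Sum>y\<in>weak_seqs D m k. q ^ m * q ^ (\<Sum>i = 1..m. y i))"
  proof (rule sum.reindex_bij_witness[of _ "\<lambda>y. \<lambda>i\<in>{1..m}. Suc (y i)"
        "\<lambda>y. \<lambda>i\<in>{1..m}. y i - 1"])
    fix y assume "y \<in> {y. y \<in> weak_seqs D m n \<and> 1 \<le> y m}"
    then have y: "y \<in> weak_seqs D m n" "1 \<le> y m" by auto
    have ext: "y \<in> {1..m} \<rightarrow>\<^sub>E {..n}" using y by (auto simp: weak_seqs_def)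
    show "(\<lambda>i\<in>{1..m}. Suc ((\<lambda>i\<in>{1..m}. y i - 1) i)) = y"
    proof
      fix i show "(\<lambda>i\<in>{1..m}. Suc ((\<lambda>i\<in>{1..m}. y i - 1) i)) i = y i"
        using pos[OF y, of i] PiE_arb[OF ext, of i] by auto
    qed
    show "(\<lambda>i\<in>{1..m}. y i - 1) \<in> weak_seqs D m k"
    proof -
      have "y (Suc i) - 1 + of_bool (i \<in> D) \<le> y i - 1" if "1 \<le> i" "i < m" for i
      proof -
        have "y (Suc i) + of_bool (i \<in> D) \<le> y i" using y that by (auto simp: weak_seqs_def)
        moreover have "1 \<le> y (Suc i)" using pos[OF y, of "Suc i"] that by auto
        ultimately show ?thesis by linarith
      qed
      moreover have "y i - 1 \<le> k" if "i \<in> {1..m}" for i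
        using ext that Suc by (fastforce simp: PiE_def Pi_def)
      ultimately show ?thesis by (auto simp: weak_seqs_def)
    qed
    show "q ^ m * q ^ (\<Sum>i = 1..m. (\<lambda>i\<in>{1..m}. y i - 1) i) = q ^ (\<Sum>i = 1..m. y i)"
      using sum_shift[OF y] by (simp add: power_add)
  next
    fix y assume y: "y \<in> weak_seqs D m k"
    have ext: "y \<in> {1..m} \<rightarrow>\<^sub>E {..k}" using y by (auto simp: weak_seqs_def)
    show "(\<lambda>i\<in>{1..m}. (\<lambda>i\<in>{1..m}. Suc (y i)) i - 1) = y"
    proof
      fix i show "(\<lambda>i\<in>{1..m}. (\<lambda>i\<in>{1..m}. Suc (y i)) i - 1) i = y i"
        using PiE_arb[OF ext, of i] by auto
    qed
    show "(\<lambda>i\<in>{1..m}. Suc (y i)) \<in> {y. y \<in> weak_seqs D m n \<and> 1 \<le> y m}"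
      using y assms Suc by (auto simp: weak_seqs_def PiE_def Pi_def)
  qed
  also have "\<dots> = q ^ m * weak_sum D m q k"
    by (simp add: weak_sum_def sum_distrib_left)
  finally show ?thesis using Suc by simp
qed

lemma weak_sum_zero_last:
  "(\<Sum>y | y \<in> weak_seqs D (Suc m) n \<and> y (Suc m) = 0. q ^ (\<Sum>i = 1..Suc m. y i)) =
   (if 1 \<le> m \<and> m \<in> D then \<Sum>y | y \<in> weak_seqs D m n \<and> 1 \<le> y m. q ^ (\<Sum>i = 1..m. y i)
    else weak_sum D m q n)"
proof -
  define A where "A = {y \<in> weak_seqs D m n. 1 \<le> m \<and> m \<in> D \<longrightarrow> 1 \<le> y m}"
  have "(\<Sum>y | y \<in> weak_seqs D (Suc m) n \<and> y (Suc m) = 0. q ^ (\<Sum>i = 1..Suc m. y i)) =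
        (\<Sum>y\<in>A. q ^ (\<Sum>i = 1..m. y i))"
  proof (rule sum.reindex_bij_witness[of _ "\<lambda>y. y(Suc m := 0)" "\<lambda>y. restrict y {1..m}"])
    fix y assume "y \<in> {y. y \<in> weak_seqs D (Suc m) n \<and> y (Suc m) = 0}"
    then have y: "y \<in> {1..Suc m} \<rightarrow>\<^sub>E {..n}" "y (Suc m) = 0"
      "\<And>i. 1 \<le> i \<Longrightarrow> i < Suc m \<Longrightarrow> y (Suc i) + of_bool (i \<in> D) \<le> y i"
      by (auto simp: weak_seqs_def)
    show "(restrict y {1..m})(Suc m := 0) = y"
    proof
      fix i show "((restrict y {1..m})(Suc m := 0)) i = y i"
        using y(2) PiE_arb[OF y(1), of i] by (auto simp: restrict_def)
    qed
    have "1 \<le> y m" if "1 \<le> m" "m \<in> D"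
      using y(3)[of m] y(2) that by simp
    then show "restrict y {1..m} \<in> A"
      using y(1,3) by (auto simp: A_def weak_seqs_def PiE_def Pi_def)
    show "q ^ (\<Sum>i = 1..m. restrict y {1..m} i) = q ^ (\<Sum>i = 1..Suc m. y i)"
      using y(2) by simp
  next
    fix y assume "y \<in> A"
    then have y: "y \<in> {1..m} \<rightarrow>\<^sub>E {..n}" "1 \<le> m \<Longrightarrow> m \<in> D \<Longrightarrow> 1 \<le> y m"
      "\<And>i. 1 \<le> i \<Longrightarrow> i < m \<Longrightarrow> y (Suc i) + of_bool (i \<in> D) \<le> y i"
      by (auto simp: A_def weak_seqs_def)
    show "restrict (y(Suc m := 0)) {1..m} = y"
    proof
      fix i show "restrict (y(Suc m := 0)) {1..m} i = y i"
        using PiE_arb[OF y(1), of i] by (auto simp: restrict_def)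
    qed
    show "y(Suc m := 0) \<in> {y. y \<in> weak_seqs D (Suc m) n \<and> y (Suc m) = 0}"
    proof -
      have "(y(Suc m := 0)) (Suc i) + of_bool (i \<in> D) \<le> (y(Suc m := 0)) i"
        if "1 \<le> i" "i < Suc m" for i
        using y(2) y(3)[of i] that by (cases "i = m") auto
      moreover have "y(Suc m := 0) \<in> {1..Suc m} \<rightarrow>\<^sub>E {..n}"
        using y(1) by (auto simp: PiE_def Pi_def extensional_def)
      ultimately show ?thesis by (simp add: weak_seqs_def)
    qed
  qed
  moreover have "A = (if 1 \<le> m \<and> m \<in> D then {y. y \<in> weak_seqs D m n \<and> 1 \<le> y m}
      else weak_seqs D m n)"
    by (auto simp: A_def)
  ultimately show ?thesis
    by (cases "1 \<le> m \<and> m \<in> D") (simp_all only: weak_sum_def if_True if_False simp_thms)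
qed

lemma weak_sum_Suc:
  "weak_sum D (Suc m) q n =
     (if n = 0 then 0 else q ^ Suc m * weak_sum D (Suc m) q (n - 1)) +
     (if 1 \<le> m \<and> m \<in> D then (if n = 0 then 0 else q ^ m * weak_sum D m q (n - 1))
      else weak_sum D m q n)"
proof -
  have split: "weak_seqs D (Suc m) n = {y. y \<in> weak_seqs D (Suc m) n \<and> 1 \<le> y (Suc m)} \<union>
       {y. y \<in> weak_seqs D (Suc m) n \<and> y (Suc m) = 0}" (is "_ = ?A \<union> ?B")
    by auto
  have "weak_sum D (Suc m) q n = (\<Sum>y\<in>?A \<union> ?B. q ^ (\<Sum>i = 1..Suc m. y i))"
    unfolding weak_sum_def by (rule sum.cong[OF split refl])
  also have "\<dots> = (\<Sum>y\<in>?A. q ^ (\<Sum>i = 1..Suc m. y i)) + (\<Sum>y\<in>?B. q ^ (\<Sum>i = 1..Suc m. y i))"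
    by (rule sum.union_disjoint) (auto intro: finite_subset[OF _ finite_weak_seqs])
  also have "\<dots> = (if n = 0 then 0 else q ^ Suc m * weak_sum D (Suc m) q (n - 1)) +
     (if 1 \<le> m \<and> m \<in> D then (if n = 0 then 0 else q ^ m * weak_sum D m q (n - 1))
      else weak_sum D m q n)"
    using weak_sum_pos_last[of "Suc m" q D n] weak_sum_pos_last[of m q D n]
      weak_sum_zero_last[of q m D n] by (simp del: sum.cl_ivl_Suc One_nat_def)
  finally show ?thesis .
qed

text \<open>For \<open>d \<le> n\<close> all terms share the factor [n+1-d]...[n+m-d], and what
  remains is [n+m+1-d] = [m+1] + q^(m+1) [n-d]. For \<open>d > n\<close> every product contains
  \<open>qnum q 0\<close>, at i = 1.\<close>

lemma weak_sum_step_identity: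
  fixes q :: "'a::comm_ring_1"
  assumes "d \<le> n \<or> 1 \<le> m" "d \<le> m"
  shows "(if n = 0 then 0 else q ^ Suc m * (\<Prod>i = 1..Suc m. qnum q (n - 1 + i - d))) +
         qnum q (Suc m) * (\<Prod>i = 1..m. qnum q (n + i - d)) = (\<Prod>i = 1..Suc m. qnum q (n + i - d))"
proof (cases "d \<le> n")
  case True
  have shift: "(\<Prod>i = 1..Suc m. qnum q (n - 1 + i - d)) =
      qnum q (n - d) * (\<Prod>i = 1..m. qnum q (n + i - d))" if "n \<noteq> 0"
  proof -
    have "(\<Prod>i = 1..Suc m. qnum q (n - 1 + i - d)) = (\<Prod>i = Suc 0..Suc m. qnum q (n + i - Suc d))"
      using that by (intro prod.cong) (auto simp: Suc_diff_le)
    also have "\<dots> = (\<Prod>i = 0..m. qnum q (n + i - d))"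
      by (subst prod.atLeast_Suc_atMost_Suc_shift) simp
    also have "\<dots> = qnum q (n - d) * (\<Prod>i = 1..m. qnum q (n + i - d))"
      by (subst prod.atLeast_Suc_atMost) auto
    finally show ?thesis .
  qed
  have "qnum q (n + Suc m - d) = qnum q (Suc m) + q ^ Suc m * qnum q (n - d)"
    using True by (subst qnum_add[symmetric]) (simp add: add.commute Suc_diff_le)
  then show ?thesis
    using shift True by (cases "n = 0") (auto simp: algebra_simps)
next
  case False
  then have "(\<Prod>i = 1..m. qnum q (n + i - d)) = 0"
    using assms by (intro prod_zero) (auto intro!: bexI[of _ 1])
  moreover have "(\<Prod>i = 1..Suc m. qnum q (n + i - d)) = 0"
    using False assms by (intro prod_zero) (auto intro!: bexI[of _ 1])
  moreover have "(\<Prod>i = 1..Suc m. qnum q (n - 1 + i - d)) = 0"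
    using False assms by (intro prod_zero) (auto intro!: bexI[of _ 1])
  ultimately show ?thesis by (simp only: mult_zero_right add_0_left if_cancel)
qed

text \<open>The subtraction on the right truncates: if \<open>n\<close> is smaller than the number of strict steps,
  the factor \<open>i = 1\<close> is \<open>qnum q 0 = 0\<close>, matching the empty sum on the left.\<close>

lemma weak_sum_closed_form:
  "(\<Prod>k = 1..m. qnum q k) * weak_sum D m q n =
     q ^ (\<Sum>(D \<inter> {1..<m})) * (\<Prod>i = 1..m. qnum q (n + i - card (D \<inter> {1..<m})))"
proof (induction m arbitrary: n)
  case 0
  have "weak_seqs D 0 n = {\<lambda>_. undefined}"
    by (auto simp: weak_seqs_def)
  then show ?case by (simp add: weak_sum_def)
next
  case (Suc m)
  define s where "s = \<Sum>(D \<inter> {1..<m})"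
  define d where "d = card (D \<inter> {1..<m})"
  define s' where "s' = \<Sum>(D \<inter> {1..<Suc m})"
  define d' where "d' = card (D \<inter> {1..<Suc m})"
  have sd: "s' = (if 1 \<le> m \<and> m \<in> D then s + m else s)"
    "d' = (if 1 \<le> m \<and> m \<in> D then Suc d else d)"
  proof -
    have "D \<inter> {1..<Suc m} = (if 1 \<le> m \<and> m \<in> D then insert m (D \<inter> {1..<m}) else D \<inter> {1..<m})"
      by (auto simp: less_Suc_eq)
    then show "s' = (if 1 \<le> m \<and> m \<in> D then s + m else s)"
      "d' = (if 1 \<le> m \<and> m \<in> D then Suc d else d)"
      by (auto simp: s_def s'_def d_def d'_def)
  qed
  have d'_le: "d' \<le> m"
    unfolding d'_def using card_mono[of "{1..<Suc m}" "D \<inter> {1..<Suc m}"] by simp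
  define M where "M = (\<Prod>k = 1..m. qnum q k)"
  have IH: "M * weak_sum D m q n = q ^ s * (\<Prod>i = 1..m. qnum q (n + i - d))" for n
    using Suc.IH by (simp add: M_def s_def d_def)
  \<comment> \<open>Both cases take one shape in s' and d'. A strict step at \<open>m\<close>
    contributes q^m, which turns s into s + m, and lowers n by one, which equals raising d by one
    inside the factors.\<close>
  have second: "M * (if 1 \<le> m \<and> m \<in> D then (if n = 0 then 0 else q ^ m * weak_sum D m q (n - 1))
      else weak_sum D m q n) = q ^ s' * (\<Prod>i = 1..m. qnum q (n + i - d'))" for n
  proof (cases "1 \<le> m \<and> m \<in> D")
    case True
    show ?thesis
    proof (cases "n = 0")
      case n: True
      have "(\<Prod>i = 1..m. qnum q (n + i - d')) = 0"
        using n True sd by (intro prod_zero) (auto intro!: bexI[of _ 1])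
      then show ?thesis using n True by simp
    next
      case False
      have "M * (q ^ m * weak_sum D m q (n - 1)) = q ^ m * (M * weak_sum D m q (n - 1))"
        by (simp only: mult_ac)
      also have "\<dots> = q ^ s' * (\<Prod>i = 1..m. qnum q (n - 1 + i - d))"
        using True by (simp add: IH sd power_add mult_ac)
      also have "(\<Prod>i = 1..m. qnum q (n - 1 + i - d)) = (\<Prod>i = 1..m. qnum q (n + i - d'))"
        using False True by (intro prod.cong) (auto simp: sd)
      finally show ?thesis using True False by simp
    qed
  next
    case False
    then have "s' = s" "d' = d" using sd by auto
    then show ?thesis using False IH by auto
  qed
  have M': "(\<Prod>k = 1..Suc m. qnum q k) = M * qnum q (Suc m)"
    by (simp add: M_def)
  have rec: "M * qnum q (Suc m) * weak_sum D (Suc m) q n =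
      (if n = 0 then 0 else q ^ Suc m * (M * qnum q (Suc m) * weak_sum D (Suc m) q (n - 1))) +
      qnum q (Suc m) * (q ^ s' * (\<Prod>i = 1..m. qnum q (n + i - d')))" for n
    unfolding second[symmetric] by (subst weak_sum_Suc) (simp add: algebra_simps)
  have main: "M * qnum q (Suc m) * weak_sum D (Suc m) q n =
      q ^ s' * (\<Prod>i = 1..Suc m. qnum q (n + i - d'))" for n
  \<comment> \<open>The recursion leads from n to n - 1 at the same \<open>m\<close>, hence a second
    induction inside the one on \<open>m\<close>.\<close>
  proof (induction n)
    case 0
    have "d' \<le> 0 \<or> 1 \<le> m" using d'_le by auto
    then show ?case
      using weak_sum_step_identity[OF _ d'_le, of 0 q]
      by (subst rec) (simp add: mult_ac del: prod.cl_ivl_Suc)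
  next
    case (Suc n)
    have d': "d' \<le> Suc n \<or> 1 \<le> m" using d'_le by auto
    have "M * qnum q (Suc m) * weak_sum D (Suc m) q (Suc n) =
        q ^ Suc m * (q ^ s' * (\<Prod>i = 1..Suc m. qnum q (n + i - d'))) +
        qnum q (Suc m) * (q ^ s' * (\<Prod>i = 1..m. qnum q (Suc n + i - d')))"
      by (subst rec) (simp only: Suc nat.distinct if_False diff_Suc_1)
    also have "\<dots> = q ^ s' * (q ^ Suc m * (\<Prod>i = 1..Suc m. qnum q (n + i - d')) +
        qnum q (Suc m) * (\<Prod>i = 1..m. qnum q (Suc n + i - d')))"
      by (simp only: distrib_left mult_ac)
    also have "\<dots> = q ^ s' * (\<Prod>i = 1..Suc m. qnum q (Suc n + i - d'))"
      using weak_sum_step_identity[OF d' d'_le, of q]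
      by (simp only: nat.distinct if_False diff_Suc_1)
    finally show ?case .
  qed
  show ?case
    using main[of n] unfolding s'_def d'_def by (simp only: M')
qed

section \<open>P-partitions and linear extensions\<close>

lemma
  assumes "naturally_labeled_poset m P"
  shows poset_sub: "(x, y) \<in> P \<Longrightarrow> x \<in> {1..m}" "(x, y) \<in> P \<Longrightarrow> y \<in> {1..m}"
    and poset_le: "(x, y) \<in> P \<Longrightarrow> x \<le> y"
    and poset_refl: "x \<in> {1..m} \<Longrightarrow> (x, x) \<in> P"
    and poset_trans: "(x, y) \<in> P \<Longrightarrow> (y, z) \<in> P \<Longrightarrow> (x, z) \<in> P"
  using assms
  by (auto simp: naturally_labeled_poset_def partial_order_on_def preorder_on_def refl_on_def
      dest: transD)

definition ppartitions :: "nat \<Rightarrow> nat rel \<Rightarrow> nat \<Rightarrow> (nat \<Rightarrow> nat) set" where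
  "ppartitions m P n = {z \<in> {1..m} \<rightarrow>\<^sub>E {..n}. \<forall>x y. (x, y) \<in> P \<longrightarrow> z y \<le> z x}"

definition before :: "(nat \<Rightarrow> nat) \<Rightarrow> nat \<Rightarrow> nat \<Rightarrow> bool" where
  "before z x y \<longleftrightarrow> z y < z x \<or> z y = z x \<and> x < y"

text \<open>The inverse of the sorting permutation. Counting x itself makes ranks start at 1, and
  the identity outside {1..m} is what \<open>permutes\<close> demands.\<close>

definition sort_rank :: "nat \<Rightarrow> (nat \<Rightarrow> nat) \<Rightarrow> nat \<Rightarrow> nat" where
  "sort_rank m z x = (if x \<in> {1..m} then card {y \<in> {1..m}. before z y x \<or> y = x} else x)"

definition sorting_perm :: "nat \<Rightarrow> (nat \<Rightarrow> nat) \<Rightarrow> nat \<Rightarrow> nat" where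
  "sorting_perm m z = inv (sort_rank m z)"

lemma before_trans: "before z x y \<Longrightarrow> before z y w \<Longrightarrow> before z x w"
  by (auto simp: before_def)

lemma before_total: "x \<noteq> y \<Longrightarrow> before z x y \<or> before z y x"
  by (auto simp: before_def)

lemma before_irrefl: "\<not> before z x x"
  by (auto simp: before_def)

lemma sort_rank_less:
  assumes "x \<in> {1..m}" "y \<in> {1..m}" "before z x y"
  shows "sort_rank m z x < sort_rank m z y"
proof -
  have "{w \<in> {1..m}. before z w x \<or> w = x} \<subset> {w \<in> {1..m}. before z w y \<or> w = y}"
    using assms before_trans before_irrefl by blast
  then show ?thesis
    using assms by (simp add: sort_rank_def psubset_card_mono)
qed

lemma sort_rank_permutes: "sort_rank m z permutes {1..m}"
proof (rule bij_imp_permutes)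
  have inj: "inj_on (sort_rank m z) {1..m}"
    by (rule inj_onI) (metis before_total sort_rank_less less_irrefl)
  have "sort_rank m z ` {1..m} \<subseteq> {1..m}"
  proof
    fix r assume "r \<in> sort_rank m z ` {1..m}"
    then obtain x where x: "x \<in> {1..m}" "r = sort_rank m z x" by auto
    have "card {x} \<le> card {y \<in> {1..m}. before z y x \<or> y = x}"
      by (rule card_mono) (use x in auto)
    moreover have "card {y \<in> {1..m}. before z y x \<or> y = x} \<le> card {1..m}"
      by (rule card_mono) auto
    ultimately show "r \<in> {1..m}" using x by (simp add: sort_rank_def)
  qed
  then show "bij_betw (sort_rank m z) {1..m} {1..m}"
    using inj endo_inj_surj[of "{1..m}" "sort_rank m z"] by (simp add: bij_betw_def)
qed (simp only: sort_rank_def if_False)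

lemma sorting_perm_permutes: "sorting_perm m z permutes {1..m}"
  unfolding sorting_perm_def by (rule permutes_inv[OF sort_rank_permutes])

lemma sorting_perm_before:
  assumes "1 \<le> i" "i < j" "j \<le> m"
  shows "before z (sorting_perm m z i) (sorting_perm m z j)"
proof (rule ccontr)
  let ?p = "sorting_perm m z"
  assume not: "\<not> before z (?p i) (?p j)"
  have rank_p: "sort_rank m z (?p k) = k" for k
    unfolding sorting_perm_def using permutes_inverses(1)[OF sort_rank_permutes] .
  have "?p i \<noteq> ?p j" using rank_p assms by (metis less_irrefl)
  then have "before z (?p j) (?p i)" using not before_total by blast
  moreover have "?p i \<in> {1..m}" "?p j \<in> {1..m}"
    using permutes_in_image[OF sorting_perm_permutes] assms by auto
  ultimately have "sort_rank m z (?p j) < sort_rank m z (?p i)" by (intro sort_rank_less)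
  then show False using rank_p assms by simp
qed

lemma sorting_perm_unique:
  assumes perm: "p permutes {1..m}"
    and step: "\<And>i. 1 \<le> i \<Longrightarrow> i < m \<Longrightarrow> before z (p i) (p (Suc i))"
  shows "sorting_perm m z = p"
proof -
  have mono: "before z (p i) (p j)" if "1 \<le> i" "i < j" "j \<le> m" for i j
    using that(2,3)
  proof (induction j)
    case (Suc j)
    have st: "before z (p j) (p (Suc j))" using step[of j] Suc.prems that(1) by simp
    show ?case
    proof (cases "i = j")
      case False
      then have "before z (p i) (p j)" using Suc by simp
      then show ?thesis using st by (rule before_trans)
    qed (use st in simp)
  qed simp
  have "sort_rank m z x = inv p x" for x
  proof (cases "x \<in> {1..m}")
    case True
    then obtain i where i: "i \<in> {1..m}" "x = p i"
      using permutes_image[OF perm] by (metis imageE)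
    have "{y \<in> {1..m}. before z y x \<or> y = x} = p ` {1..i}"
    proof (intro equalityI subsetI)
      fix y assume "y \<in> {y \<in> {1..m}. before z y x \<or> y = x}"
      then have y: "y \<in> {1..m}" "before z y x \<or> y = x" by auto
      then obtain k where k: "k \<in> {1..m}" "y = p k"
        using permutes_image[OF perm] by (metis imageE)
      have "\<not> i < k"
      proof
        assume "i < k"
        then have "before z x y" using mono[of i k] i k by auto
        then show False using y before_trans before_irrefl by blast
      qed
      then show "y \<in> p ` {1..i}" using k by auto
    next
      fix y assume "y \<in> p ` {1..i}"
      then obtain k where k: "1 \<le> k" "k \<le> i" "y = p k" by auto
      then have "y \<in> {1..m}" using i permutes_in_image[OF perm, of k] by auto
      moreover have "before z y x \<or> y = x"
        using mono[of k i] i k by (cases "k = i") auto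
      ultimately show "y \<in> {y \<in> {1..m}. before z y x \<or> y = x}" by simp
    qed
    then have "sort_rank m z x = card (p ` {1..i})" using True by (simp add: sort_rank_def)
    also have "\<dots> = i"
      by (subst card_image) (use permutes_inj_on[OF perm] in auto)
    finally show ?thesis using i permutes_inverses(2)[OF perm] by simp
  next
    case False
    then show ?thesis
      using permutes_not_in[OF permutes_inv[OF perm] False] by (simp only: sort_rank_def if_False)
  qed
  then have "sort_rank m z = inv p" by auto
  then show ?thesis
    unfolding sorting_perm_def using permutes_inv_inv[OF perm] by simp
qed

text \<open>Stanley's fundamental lemma of P-partitions.\<close>

lemma ppartition_sum:
  fixes q :: "'a::comm_ring_1"
  assumes P: "naturally_labeled_poset m P"
  shows "(\<Sum>\<pi>\<in>linear_extensions m P. weak_sum (descents m \<pi>) m q n) =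
         (\<Sum>z\<in>ppartitions m P n. q ^ (\<Sum>i = 1..m. z i))"
proof -
  let ?L = "linear_extensions m P"
  \<comment> \<open>\<open>H\<close> splits a map into its sorting permutation and its sorted word;
    \<open>G\<close> puts the word back on the labels.\<close>
  define G where "G = (\<lambda>(\<pi> :: nat \<Rightarrow> nat, y :: nat \<Rightarrow> nat). restrict (y \<circ> inv \<pi>) {1..m})"
  define H where "H = (\<lambda>z. (sorting_perm m z, restrict (z \<circ> sorting_perm m z) {1..m}) ::
    (nat \<Rightarrow> nat) \<times> (nat \<Rightarrow> nat))"
  note P_sub = poset_sub[OF P] poset_le[OF P]
  have fin: "finite ?L"
    by (rule finite_subset[OF _ finite_permutations[of "{1..m}"]]) (auto simp: linear_extensions_def)
  have "(\<Sum>\<pi>\<in>?L. weak_sum (descents m \<pi>) m q n) =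
      (\<Sum>(\<pi>, y)\<in>Sigma ?L (\<lambda>\<pi>. weak_seqs (descents m \<pi>) m n). q ^ (\<Sum>i = 1..m. y i))"
    unfolding weak_sum_def by (rule sum.Sigma) (use fin finite_weak_seqs in auto)
  also have "\<dots> = (\<Sum>z\<in>ppartitions m P n. q ^ (\<Sum>i = 1..m. z i))"
  proof (rule sum.reindex_bij_witness[of _ H G])
    fix a assume "a \<in> Sigma ?L (\<lambda>\<pi>. weak_seqs (descents m \<pi>) m n)"
    then obtain \<pi> y where a: "a = (\<pi>, y)" and \<pi>: "\<pi> \<in> ?L"
      and y: "y \<in> weak_seqs (descents m \<pi>) m n" by auto
    have perm: "\<pi> permutes {1..m}"
      using \<pi> unfolding linear_extensions_def by blast
    have ext: "i \<le> j" if "i \<in> {1..m}" "j \<in> {1..m}" "(\<pi> i, \<pi> j) \<in> P" for i j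
      using \<pi> that unfolding linear_extensions_def by blast
    have y_ext: "y \<in> {1..m} \<rightarrow>\<^sub>E {..n}" using y by (auto simp: weak_seqs_def)
    define z where "z = G a"
    have z: "z (\<pi> i) = y i" if "i \<in> {1..m}" for i
      using that permutes_in_image[OF perm, of i] permutes_inverses[OF perm]
      by (simp add: z_def a G_def)
    \<comment> \<open>A descent forces a strict drop of the values. Elsewhere the labels ascend,
      which is how \<open>before\<close> breaks ties.\<close>
    have "before z (\<pi> i) (\<pi> (Suc i))" if "1 \<le> i" "i < m" for i
    proof -
      have "y (Suc i) + of_bool (i \<in> descents m \<pi>) \<le> y i"
        using y that by (auto simp: weak_seqs_def)
      moreover have "\<pi> i \<noteq> \<pi> (Suc i)"
        using permutes_inj[OF perm] by (metis injD n_not_Suc_n)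
      ultimately show ?thesis
        using that z[of i] z[of "Suc i"]
        by (cases "i \<in> descents m \<pi>") (auto simp: before_def descents_def)
    qed
    then have srt: "sorting_perm m z = \<pi>"
      by (intro sorting_perm_unique perm)
    have "restrict (z \<circ> \<pi>) {1..m} = y"
      using z PiE_arb[OF y_ext] by (auto simp: restrict_def)
    then show "H (G a) = a"
      unfolding z_def[symmetric] by (simp add: H_def srt a)
    have "z w \<le> z x" if "(x, w) \<in> P" for x w
    proof -
      have "x \<in> \<pi> ` {1..m}" "w \<in> \<pi> ` {1..m}"
        using P_sub[OF that] permutes_image[OF perm] by simp_all
      then obtain i j where ij: "x = \<pi> i" "i \<in> {1..m}" "w = \<pi> j" "j \<in> {1..m}"
        by (elim imageE)
      have "i \<le> j"
        by (rule ext) (use ij that in simp_all)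
      then show ?thesis
        using weak_seqs_decreasing[OF y, of i j] z ij by auto
    qed
    moreover have "z \<in> {1..m} \<rightarrow>\<^sub>E {..n}"
      using y_ext permutes_in_image[OF permutes_inv[OF perm]]
      by (auto simp: z_def a G_def PiE_def Pi_def)
    ultimately show "G a \<in> ppartitions m P n"
      by (simp add: ppartitions_def z_def)
    have "(\<Sum>i = 1..m. z i) = (\<Sum>i = 1..m. (z \<circ> \<pi>) i)"
      by (rule sum.permute[OF perm])
    also have "\<dots> = (\<Sum>i = 1..m. y i)" using z by simp
    finally show "q ^ (\<Sum>i = 1..m. G a i) = (case a of (\<pi>, y) \<Rightarrow> q ^ (\<Sum>i = 1..m. y i))"
      by (simp add: z_def a)
  next
    fix z assume "z \<in> ppartitions m P n"
    then have z_ext: "z \<in> {1..m} \<rightarrow>\<^sub>E {..n}"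
      and z_rev: "\<And>x y. (x, y) \<in> P \<Longrightarrow> z y \<le> z x"
      by (auto simp: ppartitions_def)
    define \<pi> where "\<pi> = sorting_perm m z"
    have perm: "\<pi> permutes {1..m}" unfolding \<pi>_def by (rule sorting_perm_permutes)
    have srt: "before z (\<pi> i) (\<pi> j)" if "1 \<le> i" "i < j" "j \<le> m" for i j
      unfolding \<pi>_def using that by (rule sorting_perm_before)
    have "i \<le> j" if "i \<in> {1..m}" "j \<in> {1..m}" "(\<pi> i, \<pi> j) \<in> P" for i j
    proof (rule ccontr)
      assume "\<not> i \<le> j"
      then have "before z (\<pi> j) (\<pi> i)" using srt[of j i] that by auto
      \<comment> \<open>Order reversal leaves only a tie, and in a tie natural labelling puts the
        lower element first.\<close>
      then show False
        using z_rev[OF that(3)] P_sub(3)[OF that(3)] by (auto simp: before_def)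
    qed
    then have L: "\<pi> \<in> ?L" using perm unfolding linear_extensions_def by blast
    have "restrict (z \<circ> \<pi>) {1..m} \<in> weak_seqs (descents m \<pi>) m n"
    proof -
      have "z (\<pi> (Suc i)) + of_bool (i \<in> descents m \<pi>) \<le> z (\<pi> i)" if "1 \<le> i" "i < m" for i
        using srt[of i "Suc i"] that by (auto simp: before_def descents_def)
      moreover have "z (\<pi> i) \<le> n" if "i \<in> {1..m}" for i
        using z_ext permutes_in_image[OF perm, of i] that by (auto simp: PiE_def Pi_def)
      ultimately show ?thesis by (auto simp: weak_seqs_def)
    qed
    then show "H z \<in> Sigma ?L (\<lambda>\<pi>. weak_seqs (descents m \<pi>) m n)"
      using L by (simp add: H_def \<pi>_def)
    show "G (H z) = z"
    proof
      fix x show "G (H z) x = z x"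
      proof (cases "x \<in> {1..m}")
        case True
        then have "inv \<pi> x \<in> {1..m}" using permutes_in_image[OF permutes_inv[OF perm]] by blast
        then show ?thesis
          using True permutes_inverses[OF perm] by (simp add: G_def H_def \<pi>_def[symmetric])
      next
        case False
        then show ?thesis using PiE_arb[OF z_ext False] by (simp only: G_def H_def split restrict_apply if_False)
      qed
    qed
  qed
  finally show ?thesis .
qed

section \<open>Evaluation at q-integers\<close>

text \<open>A set of c + 1 naturals has maximum at least c, so removing the maximum drives the
  induction. This single estimate bounds \<open>maj\<close> from both sides and compares the sum of
  \<open>mc\<close> over a set with the sorted sum.\<close>

lemma sum_initial_le:
  fixes h :: "nat \<Rightarrow> nat"
  assumes "finite K" "K \<subseteq> {..<N}" "mono_on {..<N} h"
  shows "(\<Sum>k<card K. h k) \<le> (\<Sum>k\<in>K. h k)"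
  using assms(1,2)
proof (induction "card K" arbitrary: K)
  case (Suc c)
  define x where "x = Max K"
  have K: "K \<noteq> {}" using Suc by auto
  then have x: "x \<in> K" using Suc by (simp add: x_def)
  have card: "card (K - {x}) = c" using Suc x by simp
  have "K - {x} \<subseteq> {..<x}"
    using Max_ge[OF \<open>finite K\<close>] by (force simp: x_def le_less)
  then have "c \<le> x" using card_mono[of "{..<x}" "K - {x}"] card by simp
  then have "h c \<le> h x" using x Suc.prems assms(3) by (intro mono_onD[OF assms(3)]) auto
  moreover have "(\<Sum>k<c. h k) \<le> (\<Sum>k\<in>K - {x}. h k)"
    using Suc.hyps(1)[of "K - {x}"] Suc.prems card by auto
  moreover have "(\<Sum>k\<in>K. h k) = h x + (\<Sum>k\<in>K - {x}. h k)"
    using Suc.prems x by (simp add: sum.remove)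
  ultimately show ?case using Suc.hyps(2)[symmetric] by simp
qed simp

lemma finite_descents: "finite (descents m \<pi>)"
  by (rule finite_subset[of _ "{..<m}"]) (auto simp: descents_def)

lemma descents_Int: "descents m \<pi> \<inter> {1..<m} = descents m \<pi>"
  by (auto simp: descents_def)

lemma des_le: "des m \<pi> \<le> m"
  using card_mono[of "{..<m}" "descents m \<pi>"] by (auto simp: des_def descents_def)

text \<open>The d descents are distinct naturals. The bound makes the truncated exponent in
  \<open>pi_term\<close> an exact difference.\<close>

lemma maj_ge: "\<Sum>{..<des m \<pi>} \<le> maj m \<pi>"
  using sum_initial_le[OF finite_descents, of m \<pi> m "\<lambda>k. k"]
  by (auto simp: des_def maj_def descents_def mono_on_def)

text \<open>The reflection i -> m - 1 - i sends the descents to d distinct naturals with sum at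
  least 0 + ... + (d-1), and r i + i + 1 = m for each descent i.\<close>

lemma maj_le: "maj m \<pi> + \<Sum>{..<Suc (des m \<pi>)} \<le> m * des m \<pi>"
proof -
  let ?D = "descents m \<pi>"
  define r where "r i = m - 1 - i" for i
  have inj: "inj_on r ?D"
    by (auto simp: inj_on_def descents_def r_def)
  have "(\<Sum>k<card (r ` ?D). k) \<le> (\<Sum>k\<in>r ` ?D. k)"
    by (rule sum_initial_le[of _ m])
      (auto simp: finite_descents mono_on_def descents_def r_def)
  then have "\<Sum>{..<des m \<pi>} \<le> (\<Sum>i\<in>?D. r i)"
    by (simp add: card_image[OF inj] des_def sum.reindex[OF inj])
  moreover have "(\<Sum>i\<in>?D. r i) + maj m \<pi> + des m \<pi> = (\<Sum>i\<in>?D. r i + i + 1)"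
    unfolding maj_def des_def by (simp only: sum.distrib) simp
  moreover have "(\<Sum>i\<in>?D. r i + i + 1) = (\<Sum>i\<in>?D. m)"
    by (rule sum.cong) (auto simp: descents_def r_def)
  ultimately show ?thesis by (simp add: des_def mult.commute)
qed

text \<open>The summand of F_P for \<open>s\<close> = maj and \<open>d\<close> = des, free of
  negative powers: for i = d - k the factor [-k] + q^(-k) x equals q^(-k) (x - [k]), and the
  extracted powers sum to 0 + ... + (d-1). For i = d + k the factor stays as it is.\<close>

definition pi_term :: "'a::comm_ring_1 \<Rightarrow> nat \<Rightarrow> nat \<Rightarrow> nat \<Rightarrow> 'a poly" where
  "pi_term q m s d = smult (q ^ (s - \<Sum>{..<d}))
     ((\<Prod>k<d. [:- qnum q k, 1:]) * (\<Prod>k = 1..m - d. [:qnum q k, q ^ k:]))"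

text \<open>Here \<open>q\<close> is an element of an arbitrary ring, so that the same polynomial can be moved between
  integer polynomials, rational functions and formal power series.\<close>

definition F_gen :: "'a::comm_ring_1 \<Rightarrow> nat \<Rightarrow> nat rel \<Rightarrow> 'a poly" where
  "F_gen q m P = (\<Sum>\<pi>\<in>linear_extensions m P. pi_term q m (maj m \<pi>) (des m \<pi>))"

lemma prod_split_at:
  assumes "d \<le> (m :: nat)"
  shows "(\<Prod>i = 1..m. g i) = (\<Prod>k<d. g (d - k)) * (\<Prod>k = 1..m - d. g (d + k))"
proof -
  have "(\<Prod>i = 1..m. g i) = (\<Prod>i = 1..d. g i) * (\<Prod>i = d + 1..d + (m - d). g i)"
    using prod.ub_add_nat[of 1 d g "m - d"] assms by simp
  also have "(\<Prod>i = 1..d. g i) = (\<Prod>k<d. g (d - k))"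
    by (rule prod.reindex_bij_witness[of _ "\<lambda>k. d - k" "\<lambda>i. d - i"]) auto
  also have "(\<Prod>i = d + 1..d + (m - d). g i) = (\<Prod>k = 1..m - d. g (d + k))"
    by (rule prod.reindex_bij_witness[of _ "\<lambda>k. d + k" "\<lambda>i. i - d"]) auto
  finally show ?thesis .
qed

text \<open>Since [n] - [k] = q^k [n-k] and [k] + q^k [n] = [n+k], the i-th factor becomes [n+i-d].
  For \<open>n < d\<close> both sides vanish: on the left by the factor with k = n, on the right by
  truncation at i = 1.\<close>

lemma poly_pi_term:
  assumes "d \<le> m" "\<Sum>{..<d} \<le> s"
  shows "poly (pi_term q m s d) (qnum q n) = q ^ s * (\<Prod>i = 1..m. qnum q (n + i - d))"
proof (cases "d \<le> n")
  case True
  have "(\<Prod>k<d. poly [:- qnum q k, 1:] (qnum q n)) = (\<Prod>k<d. q ^ k * qnum q (n - k))"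
  proof (rule prod.cong)
    fix k assume "k \<in> {..<d}"
    then have "qnum q n = qnum q k + q ^ k * qnum q (n - k)"
      using True qnum_add[of q k "n - k"] by simp
    then show "poly [:- qnum q k, 1:] (qnum q n) = q ^ k * qnum q (n - k)" by simp
  qed simp
  also have "\<dots> = q ^ \<Sum>{..<d} * (\<Prod>k<d. qnum q (n + (d - k) - d))"
    by (simp add: prod.distrib power_sum True)
  finally have 1: "(\<Prod>k<d. poly [:- qnum q k, 1:] (qnum q n)) =
      q ^ \<Sum>{..<d} * (\<Prod>k<d. qnum q (n + (d - k) - d))" .
  have 2: "(\<Prod>k = 1..m - d. poly [:qnum q k, q ^ k:] (qnum q n)) =
      (\<Prod>k = 1..m - d. qnum q (n + (d + k) - d))"
    by (rule prod.cong) (auto simp: qnum_add[symmetric] add_ac mult.commute)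
  have "poly (pi_term q m s d) (qnum q n) = q ^ (s - \<Sum>{..<d}) * (q ^ \<Sum>{..<d} *
      ((\<Prod>k<d. qnum q (n + (d - k) - d)) * (\<Prod>k = 1..m - d. qnum q (n + (d + k) - d))))"
    unfolding pi_term_def poly_smult poly_mult poly_prod 1 2 by (simp only: mult.assoc)
  also have "\<dots> = q ^ (s - \<Sum>{..<d} + \<Sum>{..<d}) * (\<Prod>i = 1..m. qnum q (n + i - d))"
    using prod_split_at[OF assms(1), of "\<lambda>i. qnum q (n + i - d)"] by (simp only: power_add mult.assoc)
  finally show ?thesis using assms(2) by simp
next
  case False
  have "(\<Prod>i = 1..m. qnum q (n + i - d)) = 0"
    using False assms by (intro prod_zero) (auto intro!: bexI[of _ 1])
  moreover have "(\<Prod>k<d. poly [:- qnum q k, 1:] (qnum q n)) = 0"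
    using False by (intro prod_zero) (auto intro!: bexI[of _ n])
  ultimately show ?thesis
    unfolding pi_term_def poly_smult poly_mult poly_prod by simp
qed

text \<open>\<open>des\<close> and \<open>maj\<close> are the size and the sum of the descent set,
  so each evaluated summand is the closed form of a \<open>weak_sum\<close>.\<close>

lemma poly_F_gen:
  assumes "naturally_labeled_poset m P"
  shows "poly (F_gen q m P) (qnum q n) =
    (\<Prod>k = 1..m. qnum q k) * (\<Sum>z\<in>ppartitions m P n. q ^ (\<Sum>i = 1..m. z i))"
proof -
  have "poly (F_gen q m P) (qnum q n) = (\<Sum>\<pi>\<in>linear_extensions m P.
      q ^ maj m \<pi> * (\<Prod>i = 1..m. qnum q (n + i - des m \<pi>)))"
    unfolding F_gen_def poly_sum by (intro sum.cong poly_pi_term des_le maj_ge refl)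
  also have "\<dots> = (\<Sum>\<pi>\<in>linear_extensions m P.
      (\<Prod>k = 1..m. qnum q k) * weak_sum (descents m \<pi>) m q n)"
    unfolding weak_sum_closed_form descents_Int maj_def des_def ..
  finally show ?thesis
    by (simp add: sum_distrib_left[symmetric] ppartition_sum[OF assms])
qed

text \<open>The rewriting [-k] = -q^(-k) [k] behind \<open>pi_term\<close>, valid in a field where
  both q and 1 - q are invertible.\<close>

lemma pi_term_field:
  fixes q :: "'a::field"
  assumes "q \<noteq> 0" "q \<noteq> 1" "d \<le> m" "\<Sum>{..<d} \<le> s"
  shows "smult (q ^ s) (\<Prod>i = 1..m. [:(1 - q powi (int i - int d)) / (1 - q),
           q powi (int i - int d):]) = pi_term q m s d"
proof -
  let ?g = "\<lambda>i. [:(1 - q powi (int i - int d)) / (1 - q), q powi (int i - int d):]"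
  have neg: "?g (d - k) = smult (1 / q ^ k) [:- qnum q k, 1:]" if "k < d" for k
  proof -
    have "int (d - k) - int d = - int k" using that by simp
    moreover have "q powi (- int k) = 1 / q ^ k"
      by (simp add: power_int_minus divide_inverse)
    moreover have "(1 - 1 / q ^ k) / (1 - q) = - (1 / q ^ k) * qnum q k"
    proof -
      have "(1 - 1 / q ^ k) = - (1 / q ^ k) * (1 - q ^ k)"
        using assms by (simp add: field_simps)
      then show ?thesis
        using assms by (simp add: one_diff_power_eq qnum_def)
    qed
    ultimately show ?thesis by simp
  qed
  have pos: "?g (d + k) = [:qnum q k, q ^ k:]" for k
    using assms by (simp add: one_diff_power_eq qnum_def)
  have "(\<Prod>i = 1..m. ?g i) = (\<Prod>k<d. smult (1 / q ^ k) [:- qnum q k, 1:]) *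
      (\<Prod>k = 1..m - d. [:qnum q k, q ^ k:])"
  proof -
    have "(\<Prod>k<d. ?g (d - k)) = (\<Prod>k<d. smult (1 / q ^ k) [:- qnum q k, 1:])"
      by (rule prod.cong[OF refl neg]) simp
    then show ?thesis
      unfolding prod_split_at[OF assms(3), of ?g] pos by (rule arg_cong)
  qed
  also have "\<dots> = smult (1 / q ^ \<Sum>{..<d}) ((\<Prod>k<d. [:- qnum q k, 1:]) *
      (\<Prod>k = 1..m - d. [:qnum q k, q ^ k:]))"
    unfolding prod_smult by (simp add: power_sum prod_dividef)
  finally show ?thesis
    using assms by (simp add: pi_term_def power_diff)
qed

section \<open>The q-Ehrhart polynomial\<close>

text \<open>Serves the transfers along \<open>embed_q\<close> into \<open>ratfun\<close>, along
  \<open>fps_of_poly\<close> into \<open>int fps\<close>, and to the constant coefficient of a power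
  series.\<close>

locale ring_morphism =
  fixes h :: "'a::comm_ring_1 \<Rightarrow> 'b::comm_ring_1"
  assumes h_add: "h (x + y) = h x + h y"
    and h_mult: "h (x * y) = h x * h y"
    and h_one: "h 1 = 1"
begin

lemma h_zero: "h 0 = 0"
  using h_add[of 0 0] by simp

lemma h_minus: "h (- x) = - h x"
  using h_add[of x "- x"] by (simp add: h_zero eq_neg_iff_add_eq_0 add.commute)

lemma h_sum: "h (sum f A) = (\<Sum>x\<in>A. h (f x))"
  by (induction A rule: infinite_finite_induct) (simp_all add: h_zero h_add)

lemma h_prod: "h (prod f A) = (\<Prod>x\<in>A. h (f x))"
  by (induction A rule: infinite_finite_induct) (simp_all add: h_one h_mult)

lemma h_power: "h (x ^ n) = h x ^ n"
  by (induction n) (simp_all add: h_one h_mult)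

lemma h_qnum: "h (qnum q n) = qnum (h q) n"
  by (simp add: qnum_def h_sum h_power)

lemma ring_morphism_map_poly: "ring_morphism (map_poly h)"
proof
  show "map_poly h (p * r) = map_poly h p * map_poly h r" for p r
    by (rule poly_eqI) (simp add: coeff_map_poly coeff_mult h_zero h_sum h_mult)
qed (simp_all add: poly_eq_iff coeff_map_poly h_zero h_add h_one)

lemma map_poly_pi_term: "map_poly h (pi_term q m s d) = pi_term (h q) m s d"
proof -
  interpret P: ring_morphism "map_poly h" by (rule ring_morphism_map_poly)
  show ?thesis
    by (simp add: pi_term_def map_poly_smult h_zero h_mult h_power P.h_mult P.h_prod
        map_poly_pCons h_minus h_qnum h_one)
qed

lemma map_poly_F_gen: "map_poly h (F_gen q m P) = F_gen (h q) m P"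
proof -
  interpret P: ring_morphism "map_poly h" by (rule ring_morphism_map_poly)
  show ?thesis
    by (simp add: F_gen_def P.h_sum map_poly_pi_term)
qed

end

section \<open>Embedding integer polynomials in q and x into polynomials over rational
  functions\<close>

abbreviation embed_q :: "int poly \<Rightarrow> ratfun" where
  "embed_q \<equiv> \<lambda>c. to_fract (map_poly rat_of_int c)"

lemma ring_morphism_embed_q: "ring_morphism embed_q"
proof -
  interpret of_int: ring_morphism rat_of_int
    by standard simp_all
  interpret Q: ring_morphism "map_poly rat_of_int"
    by (rule of_int.ring_morphism_map_poly)
  show ?thesis
    by standard (simp_all add: Q.h_add Q.h_mult)
qed

lemma embed_q_var: "embed_q [:0, 1:] = qvar"
  by (simp add: qvar_def map_poly_pCons)

lemma inj_embed_qx: "inj embed_qx"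
proof (rule injI)
  fix f g :: "int poly poly" assume eq: "embed_qx f = embed_qx g"
  have "embed_q (coeff f j) = embed_q (coeff g j)" for j
    using arg_cong[OF eq, of "\<lambda>p. coeff p j"] by (simp add: embed_qx_def coeff_map_poly)
  then have eq': "map_poly rat_of_int (coeff f j) = map_poly rat_of_int (coeff g j)" for j
    by simp
  have "coeff (coeff f j) i = coeff (coeff g j) i" for i j
    using arg_cong[OF eq'[of j], of "\<lambda>p. coeff p i"] by (simp add: coeff_map_poly)
  then show "f = g" by (intro poly_eqI)
qed

lemma qvar_power: "qvar ^ n = to_fract (monom 1 n)"
  by (induction n) (simp_all add: qvar_def monom_Suc flip: to_fract_mult)

lemma inj_qvar_power: "inj (\<lambda>n. qvar ^ n)"
  by (rule injI) (simp add: qvar_power monom_eq_iff')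

lemma qvar_neq: "qvar \<noteq> 0" "qvar \<noteq> 1"
  using injD[OF inj_qvar_power, of 1 0] by (auto simp: qvar_def)

lemma one_minus_mult_qnum: "(1 - q) * qnum q n = 1 - q ^ n"
  by (simp add: qnum_def one_diff_power_eq)

lemma inj_qnum:
  assumes "inj (\<lambda>n. q ^ n)"
  shows "inj (qnum q)"
proof (rule injI)
  fix a b assume "qnum q a = qnum q b"
  then have "1 - q ^ a = 1 - q ^ b" by (metis one_minus_mult_qnum)
  then show "a = b" using injD[OF assms, of a b] by simp
qed

lemma poly_eqI_infinite:
  fixes p r :: "'a::idom poly" and f :: "nat \<Rightarrow> 'a"
  assumes "inj f" "\<And>n. poly p (f n) = poly r (f n)"
  shows "p = r"
proof (rule ccontr)
  assume "p \<noteq> r"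
  then have "finite {x. poly (p - r) x = 0}" by (intro poly_roots_finite) simp
  moreover have "range f \<subseteq> {x. poly (p - r) x = 0}" using assms(2) by auto
  ultimately show False using range_inj_infinite[OF assms(1)] finite_subset by blast
qed

lemma qint_of_nat: "qint (int n) = qnum qvar n"
  using one_minus_mult_qnum[of qvar n] qvar_neq by (simp add: qint_def field_simps)

lemma F_sum_eq: "F_sum m P = F_gen qvar m P"
  unfolding F_sum_def F_gen_def qint_def
  by (intro sum.cong refl pi_term_field qvar_neq des_le maj_ge)

lemma embed_F_gen: "embed_qx (F_gen [:0, 1:] m P) = F_sum m P"
  unfolding embed_qx_def F_sum_eq
  by (subst ring_morphism.map_poly_F_gen[OF ring_morphism_embed_q]) (simp only: embed_q_var)

text \<open>In the definite description, existence is \<open>embed_F_gen\<close> and uniqueness is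
  \<open>inj_embed_qx\<close>.\<close>

lemma F_poly_eq: "F_poly m P = F_gen [:0, 1:] m P"
  unfolding F_poly_def using embed_F_gen injD[OF inj_embed_qx]
  by (intro the_equality) (auto simp flip: embed_F_gen)

section \<open>Lattice points of dilated order polytopes\<close>

lemma lattice_points_order_polytope:
  assumes P: "naturally_labeled_poset m P"
  shows "lattice_points m (dilate m n (order_polytope m (P\<inverse>))) =
         (\<lambda>z. \<lambda>i\<in>{1..m}. int (z i)) ` ppartitions m P n"
proof (intro equalityI subsetI)
  note P_sub = poset_sub[OF P]
  {
    fix w assume "w \<in> lattice_points m (dilate m n (order_polytope m (P\<inverse>)))"
    then obtain x where w: "w \<in> {1..m} \<rightarrow>\<^sub>E UNIV"
      and x: "x \<in> order_polytope m (P\<inverse>)"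
      and eq: "(\<lambda>i\<in>{1..m}. real_of_int (w i)) = (\<lambda>i\<in>{1..m}. real n * x i)"
      by (auto simp: lattice_points_def dilate_def)
    have wx: "real_of_int (w i) = real n * x i" if "i \<in> {1..m}" for i
      using fun_cong[OF eq, of i] that by simp
    have x01: "0 \<le> x i" "x i \<le> 1" if "i \<in> {1..m}" for i
      using x that by (auto simp: order_polytope_def PiE_def Pi_def)
    have w0: "0 \<le> w i" if "i \<in> {1..m}" for i
      using wx[OF that] x01[OF that] by (metis mult_nonneg_nonneg of_int_0_le_iff of_nat_0_le_iff)
    have wn: "w i \<le> int n" if "i \<in> {1..m}" for i
    proof -
      have "real n * x i \<le> real n" using x01[OF that] by (simp add: mult_left_le)
      then show ?thesis using wx[OF that] by linarith
    qed
    define z where "z = (\<lambda>i\<in>{1..m}. nat (w i))"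
    have "z b \<le> z a" if ab: "(a, b) \<in> P" for a b
    proof -
      have "x b \<le> x a" using x ab by (auto simp: order_polytope_def)
      then have "real n * x b \<le> real n * x a" by (simp add: mult_left_mono)
      then have "w b \<le> w a" using wx P_sub[OF ab] by (metis of_int_le_iff)
      then show ?thesis using P_sub[OF ab] by (simp add: z_def nat_mono)
    qed
    then have "z \<in> ppartitions m P n"
      using wn by (auto simp: ppartitions_def z_def nat_le_iff)
    moreover have "w = (\<lambda>i\<in>{1..m}. int (z i))"
      using w0 PiE_arb[OF w] by (auto simp: z_def restrict_def)
    ultimately show "w \<in> (\<lambda>z. \<lambda>i\<in>{1..m}. int (z i)) ` ppartitions m P n" by blast
  }
  {
    fix w assume "w \<in> (\<lambda>z. \<lambda>i\<in>{1..m}. int (z i)) ` ppartitions m P n"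
    then obtain z where z: "z \<in> {1..m} \<rightarrow>\<^sub>E {..n}" "\<And>x y. (x, y) \<in> P \<Longrightarrow> z y \<le> z x"
      and w: "w = (\<lambda>i\<in>{1..m}. int (z i))"
      by (auto simp: ppartitions_def)
    have zn: "z i \<le> n" if "i \<in> {1..m}" for i
      using z(1) that by (auto simp: PiE_def Pi_def)
    \<comment> \<open>For n = 0 the division returns 0. The zero point lies in the polytope and z i
      <= 0 forces z = 0 on {1..m}, so dilating x still gives z.\<close>
    define x where "x = (\<lambda>i\<in>{1..m}. real (z i) / real n)"
    have "x i \<le> x j" if "(i, j) \<in> P\<inverse>" for i j
      using z(2)[of j i] P_sub[of j i] that by (auto simp: x_def divide_right_mono)
    then have "x \<in> order_polytope m (P\<inverse>)"
      using zn by (auto simp: order_polytope_def x_def divide_le_eq_1)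
    moreover have "(\<lambda>i\<in>{1..m}. real_of_int (w i)) = (\<lambda>i\<in>{1..m}. real n * x i)"
    proof (rule restrict_ext)
      fix i assume i: "i \<in> {1..m}"
      show "real_of_int (w i) = real n * x i"
        using zn[OF i] i by (cases "n = 0") (auto simp: w x_def)
    qed
    ultimately show "w \<in> lattice_points m (dilate m n (order_polytope m (P\<inverse>)))"
      by (auto simp: lattice_points_def dilate_def w)
  }
qed

lemma lattice_point_sum:
  assumes P: "naturally_labeled_poset m P"
  shows "(\<Sum>w\<in>lattice_points m (dilate m n (order_polytope m (P\<inverse>))). q powi (\<Sum>i = 1..m. w i)) =
         (\<Sum>z\<in>ppartitions m P n. q ^ (\<Sum>i = 1..m. z i))"
proof -
  have "inj_on (\<lambda>z. \<lambda>i\<in>{1..m}. int (z i)) (ppartitions m P n)"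
  proof (rule inj_onI)
    fix y z assume yz: "y \<in> ppartitions m P n" "z \<in> ppartitions m P n"
      and eq: "(\<lambda>i\<in>{1..m}. int (y i)) = (\<lambda>i\<in>{1..m}. int (z i))"
    show "y = z"
    proof (rule PiE_ext)
      show "y \<in> {1..m} \<rightarrow>\<^sub>E {..n}" "z \<in> {1..m} \<rightarrow>\<^sub>E {..n}"
        using yz by (simp_all add: ppartitions_def)
      show "y i = z i" if "i \<in> {1..m}" for i
        using fun_cong[OF eq, of i] that by simp
    qed
  qed
  then show ?thesis
    unfolding lattice_points_order_polytope[OF P]
    by (subst sum.reindex) (simp_all flip: of_nat_sum)
qed

lemma qfact_eq: "qfact m = (\<Prod>k = 1..m. qnum qvar k)"
  by (simp add: qfact_def qint_of_nat)

lemma qfact_nonzero: "qfact m \<noteq> 0"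
proof -
  have "qnum qvar k \<noteq> 0" if "k \<in> {1..m}" for k
    using injD[OF inj_qnum[OF inj_qvar_power], of k 0] that by auto
  then show ?thesis by (simp add: qfact_eq)
qed

text \<open>Dividing by the nonzero \<open>qfact m\<close> gives a polynomial with the required
  values. It is the only one because the powers of \<open>qvar\<close>, hence the q-integers, are
  pairwise distinct.\<close>

lemma q_Ehrhart_eq:
  assumes P: "naturally_labeled_poset m P"
  shows "smult (qfact m) (q_Ehrhart m (P\<inverse>)) = F_sum m P"
proof -
  define E where "E = smult (inverse (qfact m)) (F_sum m P)"
  have val: "poly E (qint (int n)) =
      (\<Sum>z\<in>lattice_points m (dilate m n (order_polytope m (P\<inverse>))). qvar powi (\<Sum>i = 1..m. z i))" for n
    unfolding E_def lattice_point_sum[OF P] F_sum_eq qint_of_nat poly_smult poly_F_gen[OF P]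
      qfact_eq[symmetric]
    using qfact_nonzero[of m] by simp
  have "q_Ehrhart m (P\<inverse>) = E"
    unfolding q_Ehrhart_def
  proof (rule the_equality)
    fix E' assume "\<forall>n. poly E' (qint (int n)) =
      (\<Sum>z\<in>lattice_points m (dilate m n (order_polytope m (P\<inverse>))). qvar powi (\<Sum>i = 1..m. z i))"
    then have "poly E' (qnum qvar n) = poly E (qnum qvar n)" for n
      using val by (simp flip: qint_of_nat)
    then show "E' = E"
      by (rule poly_eqI_infinite[OF inj_qnum[OF inj_qvar_power]])
  qed (use val in blast)
  then show ?thesis using qfact_nonzero[of m] by (simp add: E_def)
qed

section \<open>Expansion over order ideals\<close>

definition order_ideals :: "nat \<Rightarrow> nat rel \<Rightarrow> nat set set" where
  "order_ideals m P = {I. I \<subseteq> {1..m} \<and> (\<forall>x y. (x, y) \<in> P \<and> y \<in> I \<longrightarrow> x \<in> I)}"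

text \<open>No condition links an element of \<open>I\<close> with one outside. For n = 0 these are
  the maps counted by S_I; the threshold n accounts for the factor y^|I| with y = q^n.\<close>

definition split_maps :: "nat \<Rightarrow> nat rel \<Rightarrow> nat set \<Rightarrow> nat \<Rightarrow> (nat \<Rightarrow> nat) set" where
  "split_maps m P I n = {z \<in> {1..m} \<rightarrow>\<^sub>E UNIV. (\<forall>x\<in>I. n < z x) \<and>
     (\<forall>x y. (x, y) \<in> P \<and> x \<noteq> y \<and> x \<in> I \<and> y \<in> I \<longrightarrow> z x < z y) \<and>
     (\<forall>x y. (x, y) \<in> P \<and> x \<notin> I \<and> y \<notin> I \<longrightarrow> z y \<le> z x)}"

lemma finite_order_ideals: "finite (order_ideals m P)"
  by (rule finite_subset[of _ "Pow {1..m}"]) (auto simp: order_ideals_def)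

lemma order_ideals_card_le: "I \<in> order_ideals m P \<Longrightarrow> card I \<le> m"
  using card_mono[of "{1..m}" I] by (simp add: order_ideals_def)

text \<open>If some value exceeds \<open>n\<close>, moving the smallest label among the elements of maximal value into or
  out of \<open>I\<close> is a sign-reversing involution; natural labelling makes it respect all constraints.\<close>

lemma split_maps_sign_sum:
  assumes P: "naturally_labeled_poset m P" and z: "z \<in> {1..m} \<rightarrow>\<^sub>E UNIV"
  shows "(\<Sum>I\<in>order_ideals m P. (- 1) ^ card I * of_bool (z \<in> split_maps m P I n)) =
         (of_bool (z \<in> ppartitions m P n) :: int)"
proof (cases "\<forall>x\<in>{1..m}. z x \<le> n")
  case True
  \<comment> \<open>With no value above n only the empty ideal qualifies, and for it the conditions
    are those of \<open>ppartitions\<close>.\<close>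
  have "I = {}" if "I \<in> order_ideals m P" "z \<in> split_maps m P I n" for I
  proof (rule ccontr)
    assume "I \<noteq> {}"
    then obtain x where "x \<in> I" by blast
    then have "x \<in> {1..m}" "n < z x"
      using that by (auto simp: order_ideals_def split_maps_def)
    then show False using True by (simp add: leD)
  qed
  then have "(\<Sum>I\<in>order_ideals m P. (- 1) ^ card I * of_bool (z \<in> split_maps m P I n)) =
      (\<Sum>I\<in>{{}}. (- 1) ^ card I * of_bool (z \<in> split_maps m P I n) :: int)"
    by (intro sum.mono_neutral_right finite_order_ideals) (auto simp: order_ideals_def)
  moreover have "z \<in> split_maps m P {} n \<longleftrightarrow> z \<in> ppartitions m P n"
    using z True by (auto simp: split_maps_def ppartitions_def PiE_def Pi_def)
  ultimately show ?thesis by simp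
next
  case False
  note nat_label = poset_le[OF P] and P_sub = poset_sub[OF P]
  define M where "M = Max (z ` {1..m})"
  define p where "p = (LEAST x. x \<in> {1..m} \<and> z x = M)"
  have ne: "{1..m} \<noteq> {}" using False by auto
  have z_le: "z x \<le> M" if "x \<in> {1..m}" for x
    using that by (simp add: M_def)
  have "M \<in> z ` {1..m}" unfolding M_def using ne by (intro Max_in) auto
  then have "\<exists>x. x \<in> {1..m} \<and> z x = M" by auto
  then have "p \<in> {1..m} \<and> z p = M" unfolding p_def by (rule LeastI_ex)
  then have p: "p \<in> {1..m}" "z p = M" by auto
  have p_least: "p \<le> x" if "x \<in> {1..m}" "z x = M" for x
    unfolding p_def using that by (intro Least_le) auto
  have M: "n < M" using False z_le by (meson leI less_le_trans)
  \<comment> \<open>Natural labelling gives x the smaller label, and p has the least label among the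
    elements of value M.\<close>
  have below: "z x < M" if "(x, p) \<in> P" "x \<noteq> p" for x
  proof -
    have "x < p" using nat_label that by (simp add: le_neq_implies_less)
    then have "z x \<noteq> M" using p_least[of x] P_sub[OF that(1)] by auto
    then show ?thesis using z_le P_sub[OF that(1)] by (simp add: le_neq_implies_less)
  qed
  define S where "S = {I \<in> order_ideals m P. z \<in> split_maps m P I n}"
  define t where "t I = (if p \<in> I then I - {p} else insert p I)" for I
  have S_iff: "I \<in> S \<longleftrightarrow> I \<subseteq> {1..m} \<and> (\<forall>x y. (x, y) \<in> P \<and> y \<in> I \<longrightarrow> x \<in> I) \<and>
     (\<forall>x\<in>I. n < z x) \<and>
     (\<forall>x y. (x, y) \<in> P \<and> x \<noteq> y \<and> x \<in> I \<and> y \<in> I \<longrightarrow> z x < z y) \<and>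
     (\<forall>x y. (x, y) \<in> P \<and> x \<notin> I \<and> y \<notin> I \<longrightarrow> z y \<le> z x)" for I
    using z by (simp add: S_def order_ideals_def split_maps_def)
  have t_in: "t I \<in> S" if "I \<in> S" for I
  proof (cases "p \<in> I")
    case True
    \<comment> \<open>Strict growth on I would need a value above M. So p is maximal in I, and
      removing it leaves an ideal.\<close>
    have no: "y \<notin> I" if "(p, y) \<in> P" "y \<noteq> p" for y
    proof
      assume "y \<in> I"
      then have "z p < z y" using \<open>I \<in> S\<close> True that unfolding S_iff by blast
      then show False using z_le P_sub[OF that(1)] p by (simp add: leD)
    qed
    have "I - {p} \<in> S"
      unfolding S_iff
    proof (intro conjI allI impI ballI)
      show "I - {p} \<subseteq> {1..m}" using that unfolding S_iff by blast
      show "x \<in> I - {p}" if "(x, y) \<in> P \<and> y \<in> I - {p}" for x y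
        using that \<open>I \<in> S\<close> no unfolding S_iff by blast
      show "n < z x" if "x \<in> I - {p}" for x
        using that \<open>I \<in> S\<close> unfolding S_iff by blast
      show "z x < z y" if "(x, y) \<in> P \<and> x \<noteq> y \<and> x \<in> I - {p} \<and> y \<in> I - {p}" for x y
        using that \<open>I \<in> S\<close> unfolding S_iff by blast
      show "z y \<le> z x" if xy: "(x, y) \<in> P \<and> x \<notin> I - {p} \<and> y \<notin> I - {p}" for x y
      proof -
        consider "x = p" | "x \<notin> I" "y = p" | "x \<notin> I" "y \<notin> I" using xy by blast
        then show ?thesis
        proof cases
          case 1
          then show ?thesis using p z_le[of y] P_sub(2)[of x y] xy by simp
        next
          case 2
          then have "x \<in> I" using \<open>I \<in> S\<close> True xy unfolding S_iff by blast
          then show ?thesis using 2 by simp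
        next
          case 3
          then show ?thesis using \<open>I \<in> S\<close> xy unfolding S_iff by blast
        qed
      qed
    qed
    then show ?thesis using True by (simp add: t_def)
  next
    case False
    \<comment> \<open>Outside I the values weakly decrease, so x would have value at least M,
      against \<open>below\<close>. Hence adding p gives an ideal again.\<close>
    have into: "x \<in> I" if "(x, p) \<in> P" "x \<noteq> p" for x
    proof (rule ccontr)
      assume "x \<notin> I"
      then have "z p \<le> z x" using \<open>I \<in> S\<close> False that unfolding S_iff by blast
      then show False using below[OF that] p by simp
    qed
    have "insert p I \<in> S"
      unfolding S_iff
    proof (intro conjI allI impI ballI)
      show "insert p I \<subseteq> {1..m}" using that p unfolding S_iff by blast
      show "x \<in> insert p I" if "(x, y) \<in> P \<and> y \<in> insert p I" for x y
        using that \<open>I \<in> S\<close> into unfolding S_iff by blast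
      show "n < z x" if "x \<in> insert p I" for x
        using that \<open>I \<in> S\<close> M p unfolding S_iff by blast
      show "z x < z y" if xy: "(x, y) \<in> P \<and> x \<noteq> y \<and> x \<in> insert p I \<and> y \<in> insert p I" for x y
      proof -
        consider "y = p" | "x = p" "y \<in> I" | "x \<in> I" "y \<in> I" using xy by blast
        then show ?thesis
        proof cases
          case 1
          then show ?thesis using below[of x] xy p by simp
        next
          case 2
          then have "p \<in> I" using \<open>I \<in> S\<close> xy unfolding S_iff by blast
          then show ?thesis using False by simp
        next
          case 3
          then show ?thesis using \<open>I \<in> S\<close> xy unfolding S_iff by blast
        qed
      qed
      show "z y \<le> z x" if "(x, y) \<in> P \<and> x \<notin> insert p I \<and> y \<notin> insert p I" for x y
        using that \<open>I \<in> S\<close> unfolding S_iff by blast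
    qed
    then show ?thesis using False by (simp add: t_def)
  qed
  have tt: "t (t I) = I" for I by (auto simp: t_def)
  have t_sign: "(- 1) ^ card (t I) = - ((- 1) ^ card I :: int)" if "I \<in> S" for I
  proof -
    have fin: "finite I" using that finite_subset unfolding S_iff by blast
    show ?thesis
    proof (cases "p \<in> I")
      case True
      then have "card I = Suc (card (t I))"
        using fin card_Suc_Diff1[of I p] by (simp add: t_def del: card_Diff_singleton)
      then show ?thesis by simp
    qed (use fin in \<open>simp add: t_def\<close>)
  qed
  \<comment> \<open>Reindexing by the involution t shows that the sum is its own negative.\<close>
  have "(\<Sum>I\<in>S. (- 1) ^ card I) = (\<Sum>I\<in>S. - ((- 1) ^ card I) :: int)"
    by (rule sum.reindex_bij_witness[of _ t t]) (use t_in tt t_sign in auto)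
  then have "(\<Sum>I\<in>S. (- 1) ^ card I) = (0 :: int)" by (simp add: sum_negf)
  moreover have "(\<Sum>I\<in>order_ideals m P. (- 1) ^ card I * of_bool (z \<in> split_maps m P I n)) =
      (\<Sum>I\<in>S. (- 1) ^ card I :: int)"
    unfolding S_def by (rule sum.mono_neutral_cong_right) (auto simp: finite_order_ideals)
  moreover have "z \<notin> ppartitions m P n"
    using M p by (auto simp: ppartitions_def PiE_def Pi_def)
  ultimately show ?thesis by simp
qed

text \<open>The sum of S_I over the ideals of size j, as a formal power series in q.\<close>

definition ideal_series :: "nat \<Rightarrow> nat rel \<Rightarrow> nat \<Rightarrow> int fps" where
  "ideal_series m P j = Abs_fps (\<lambda>N. \<Sum>I | I \<in> order_ideals m P \<and> card I = j.
     int (card {z \<in> split_maps m P I 0. (\<Sum>i = 1..m. z i) = N}))"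

text \<open>Makes the cardinalities in \<open>ideal_series\<close> genuine counts, since
  \<open>card\<close> is 0 on infinite sets.\<close>

lemma finite_maps_with_sum: "finite {z \<in> {1..m :: nat} \<rightarrow>\<^sub>E UNIV. (\<Sum>i = 1..m. z i) = (N :: nat)}"
proof (rule finite_subset)
  show "{z \<in> {1..m} \<rightarrow>\<^sub>E UNIV. (\<Sum>i = 1..m. z i) = N} \<subseteq> {1..m} \<rightarrow>\<^sub>E {..N}"
  proof
    fix z assume "z \<in> {z \<in> {1..m} \<rightarrow>\<^sub>E UNIV. (\<Sum>i = 1..m. z i) = N}"
    then have z: "z \<in> {1..m} \<rightarrow>\<^sub>E UNIV" "(\<Sum>i = 1..m. z i) = N" by auto
    have "z i \<le> N" if "i \<in> {1..m}" for i
      using member_le_sum[of i "{1..m}" z] that z by simp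
    then show "z \<in> {1..m} \<rightarrow>\<^sub>E {..N}" using z by (auto simp: PiE_def)
  qed
qed (simp add: finite_PiE)

lemma sum_shift_on:
  fixes w :: "nat \<Rightarrow> nat"
  assumes "I \<subseteq> {1..m}"
  shows "(\<Sum>i = 1..m. if i \<in> I then w i + n else w i) = (\<Sum>i = 1..m. w i) + n * card I"
proof -
  have "(\<Sum>i = 1..m. if i \<in> I then w i + n else w i) = (\<Sum>i = 1..m. w i + (if i \<in> I then n else 0))"
    by (rule sum.cong) auto
  also have "\<dots> = (\<Sum>i = 1..m. w i) + (\<Sum>i\<in>{1..m} \<inter> I. n)"
    by (simp add: sum.distrib sum.If_cases)
  finally show ?thesis using assms by (simp add: Int_absorb1 mult.commute)
qed

text \<open>Raising all values on \<open>I\<close> by n moves the threshold from 0 to n and changes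
  no comparison within \<open>I\<close> or within its complement.\<close>

lemma split_maps_shift_iff:
  assumes P: "naturally_labeled_poset m P" and I: "I \<subseteq> {1..m}" and z: "z \<in> {1..m} \<rightarrow>\<^sub>E UNIV"
  shows "(\<lambda>i\<in>{1..m}. if i \<in> I then z i + n else z i) \<in> split_maps m P I n \<longleftrightarrow>
         z \<in> split_maps m P I 0"
proof -
  note P_sub = poset_sub[OF P]
  define w where "w = (\<lambda>i\<in>{1..m}. if i \<in> I then z i + n else z i)"
  have w_in: "w x = z x + n" if "x \<in> I" for x using that I by (auto simp: w_def)
  have w_out: "w x = z x" if "x \<notin> I" "x \<in> {1..m}" for x using that by (simp add: w_def)
  have "(\<forall>x\<in>I. n < w x) \<longleftrightarrow> (\<forall>x\<in>I. 0 < z x)"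
    using w_in by simp
  moreover have "(\<forall>x y. (x, y) \<in> P \<and> x \<noteq> y \<and> x \<in> I \<and> y \<in> I \<longrightarrow> w x < w y) \<longleftrightarrow>
      (\<forall>x y. (x, y) \<in> P \<and> x \<noteq> y \<and> x \<in> I \<and> y \<in> I \<longrightarrow> z x < z y)"
    by (intro iff_allI) (auto simp: w_in)
  moreover have "(\<forall>x y. (x, y) \<in> P \<and> x \<notin> I \<and> y \<notin> I \<longrightarrow> w y \<le> w x) \<longleftrightarrow>
      (\<forall>x y. (x, y) \<in> P \<and> x \<notin> I \<and> y \<notin> I \<longrightarrow> z y \<le> z x)"
    by (intro iff_allI) (metis w_out P_sub)
  moreover have "w \<in> {1..m} \<rightarrow>\<^sub>E UNIV" by (simp add: w_def)
  ultimately show ?thesis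
    using z unfolding w_def[symmetric] split_maps_def mem_Collect_eq by (simp only: simp_thms)
qed

lemma card_split_maps_shift:
  assumes P: "naturally_labeled_poset m P" and "I \<in> order_ideals m P"
  shows "card {z \<in> split_maps m P I n. (\<Sum>i = 1..m. z i) = N} =
         card {z \<in> split_maps m P I 0. (\<Sum>i = 1..m. z i) + n * card I = N}"
proof (rule bij_betw_same_card)
  let ?down = "\<lambda>z. \<lambda>i\<in>{1..m}. if i \<in> I then z i - n else z i"
  let ?up = "\<lambda>z. \<lambda>i\<in>{1..m}. if i \<in> I then z i + n else z i"
  let ?A = "{z \<in> split_maps m P I n. (\<Sum>i = 1..m. z i) = N}"
  let ?B = "{z \<in> split_maps m P I 0. (\<Sum>i = 1..m. z i) + n * card I = N}"
  have I: "I \<subseteq> {1..m}" using assms by (simp add: order_ideals_def)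
  have ext: "z \<in> {1..m} \<rightarrow>\<^sub>E UNIV" if "z \<in> split_maps m P I k" for z k
    using that by (simp add: split_maps_def)
  have ud: "?up (?down z) = z" if z: "z \<in> split_maps m P I n" for z
  proof
    fix i
    \<comment> \<open>Hence the truncated subtraction in \<open>?down\<close> is exact.\<close>
    have "n < z i" if "i \<in> I"
      using z that by (simp add: split_maps_def)
    then show "?up (?down z) i = z i"
      using PiE_arb[OF ext[OF z], of i] by auto
  qed
  have du: "?down (?up z) = z" if z: "z \<in> split_maps m P I 0" for z
  proof
    fix i show "?down (?up z) i = z i"
      using PiE_arb[OF ext[OF z], of i] by auto
  qed
  have sum_up: "(\<Sum>i = 1..m. ?up w i) = (\<Sum>i = 1..m. w i) + n * card I" for w
    using sum_shift_on[OF I, of w n] by simp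
  show "bij_betw ?down ?A ?B"
  proof (rule bij_betw_byWitness[where f' = ?up])
    show "?down ` ?A \<subseteq> ?B"
    proof
      fix w assume "w \<in> ?down ` ?A"
      then obtain z where z: "z \<in> split_maps m P I n" "(\<Sum>i = 1..m. z i) = N" "w = ?down z" by blast
      have up: "?up w = z" unfolding z(3) by (rule ud[OF z(1)])
      have "(\<Sum>i = 1..m. w i) + n * card I = N"
        using sum_up[of w] z(2) unfolding up by simp
      moreover have "w \<in> {1..m} \<rightarrow>\<^sub>E UNIV" using z(3) by simp
      then have "w \<in> split_maps m P I 0"
        using split_maps_shift_iff[OF P I, of w n] z(1) unfolding up by simp
      ultimately show "w \<in> ?B" by simp
    qed
    show "?up ` ?B \<subseteq> ?A"
    proof
      fix w assume "w \<in> ?up ` ?B"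
      then obtain z where z: "z \<in> split_maps m P I 0" "(\<Sum>i = 1..m. z i) + n * card I = N"
        "w = ?up z" by blast
      have "(\<Sum>i = 1..m. w i) = N" using sum_up[of z] z by simp
      moreover have "w \<in> split_maps m P I n"
        using split_maps_shift_iff[OF P I ext[OF z(1)], of n] z(1,3) by simp
      ultimately show "w \<in> ?A" by simp
    qed
  qed (use ud du in auto)
qed

lemma ideal_series_shift_nth:
  assumes P: "naturally_labeled_poset m P"
  shows "fps_nth (fps_X ^ (n * j) * ideal_series m P j) N =
    (\<Sum>I | I \<in> order_ideals m P \<and> card I = j.
       int (card {z \<in> split_maps m P I n. (\<Sum>i = 1..m. z i) = N}))"
proof -
  have "card {z \<in> split_maps m P I n. (\<Sum>i = 1..m. z i) = N} =
      (if N < n * j then 0 else card {z \<in> split_maps m P I 0. (\<Sum>i = 1..m. z i) = N - n * j})"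
    if "I \<in> order_ideals m P" "card I = j" for I
  proof (cases "N < n * j")
    case True
    then have "{z \<in> split_maps m P I 0. (\<Sum>i = 1..m. z i) + n * card I = N} = {}"
      using that by auto
    then show ?thesis unfolding card_split_maps_shift[OF P that(1), of n N] using True by (simp only: card.empty if_True)
  next
    case False
    then have "{z \<in> split_maps m P I 0. (\<Sum>i = 1..m. z i) + n * card I = N} =
        {z \<in> split_maps m P I 0. (\<Sum>i = 1..m. z i) = N - n * j}"
      using that by auto
    then show ?thesis unfolding card_split_maps_shift[OF P that(1), of n N] using False by (simp only: if_False)
  qed
  then show ?thesis
    by (simp add: fps_X_power_mult_nth ideal_series_def)
qed

text \<open>In the coefficient of q^N the sums over ideals and over maps with total N are exchanged;
  the inner signed sum is then the indicator from \<open>split_maps_sign_sum\<close>.\<close>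

lemma ppartitions_series:
  assumes P: "naturally_labeled_poset m P"
  shows "(\<Sum>z\<in>ppartitions m P n. fps_X ^ (\<Sum>i = 1..m. z i)) =
    (\<Sum>j\<le>m. (- 1) ^ j * ((fps_X ^ n) ^ j * ideal_series m P j))"
proof (rule fps_ext)
  fix N :: nat
  let ?A = "{z \<in> {1..m} \<rightarrow>\<^sub>E UNIV. (\<Sum>i = 1..m. z i) = N}"
  let ?c = "\<lambda>I. int (card {z \<in> split_maps m P I n. (\<Sum>i = 1..m. z i) = N})"
  have c: "?c I = (\<Sum>z\<in>?A. of_bool (z \<in> split_maps m P I n))" for I
  proof -
    have "{z \<in> split_maps m P I n. (\<Sum>i = 1..m. z i) = N} = ?A \<inter> {z. z \<in> split_maps m P I n}"
      by (auto simp: split_maps_def)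
    moreover have "(\<Sum>z\<in>?A. of_bool (z \<in> split_maps m P I n)) =
        int (card (?A \<inter> {z. z \<in> split_maps m P I n}))"
      by (simp only: sum_of_bool_eq finite_maps_with_sum)
    ultimately show ?thesis by (simp only:)
  qed
  have fin_pp: "finite (ppartitions m P n)"
    by (rule finite_subset[of _ "{1..m} \<rightarrow>\<^sub>E {..n}"]) (auto simp: ppartitions_def finite_PiE)
  have minus_one: "fps_nth ((- 1) ^ j * f) N = (- 1) ^ j * fps_nth f N" for j and f :: "int fps"
    by (cases "even j") simp_all
  have "fps_nth (\<Sum>j\<le>m. (- 1) ^ j * ((fps_X ^ n) ^ j * ideal_series m P j)) N =
      (\<Sum>j\<le>m. (- 1) ^ j * (\<Sum>I | I \<in> order_ideals m P \<and> card I = j. ?c I))"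
    by (simp only: fps_sum_nth minus_one power_mult[symmetric] ideal_series_shift_nth[OF P])
  also have "\<dots> = (\<Sum>j\<le>m. \<Sum>I | I \<in> order_ideals m P \<and> card I = j. (- 1) ^ card I * ?c I)"
    by (simp add: sum_distrib_left)
  also have "\<dots> = (\<Sum>I\<in>order_ideals m P. (- 1) ^ card I * ?c I)"
    by (rule sum.group) (auto simp: finite_order_ideals order_ideals_card_le)
  also have "\<dots> = (\<Sum>z\<in>?A. \<Sum>I\<in>order_ideals m P. (- 1) ^ card I * of_bool (z \<in> split_maps m P I n))"
    unfolding c sum_distrib_left by (rule sum.swap)
  also have "\<dots> = (\<Sum>z\<in>?A. of_bool (z \<in> ppartitions m P n))"
    by (rule sum.cong[OF refl], rule split_maps_sign_sum[OF P]) simp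
  also have "\<dots> = int (card {z \<in> ppartitions m P n. (\<Sum>i = 1..m. z i) = N})"
  proof -
    have "{z \<in> ppartitions m P n. (\<Sum>i = 1..m. z i) = N} = ?A \<inter> {z. z \<in> ppartitions m P n}"
      by (auto simp: ppartitions_def PiE_def)
    then show ?thesis by (simp only: sum_of_bool_eq finite_maps_with_sum)
  qed
  also have "\<dots> = (\<Sum>z\<in>ppartitions m P n. of_bool ((\<Sum>i = 1..m. z i) = N))"
    by (subst sum_of_bool_eq[OF fin_pp fin_pp]) (simp add: Collect_conj_eq)
  also have "\<dots> = fps_nth (\<Sum>z\<in>ppartitions m P n. fps_X ^ (\<Sum>i = 1..m. z i)) N"
    unfolding fps_sum_nth by (rule sum.cong) auto
  finally show "fps_nth (\<Sum>z\<in>ppartitions m P n. fps_X ^ (\<Sum>i = 1..m. z i)) N =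
      fps_nth (\<Sum>j\<le>m. (- 1) ^ j * ((fps_X ^ n) ^ j * ideal_series m P j)) N" ..
qed

text \<open>The linear polynomial 1 + (q - 1) x takes the value q^n at x = [n], so it is the y of
  the expansion. Both sides agree at all [n], which are distinct points of the integral domain
  \<open>int fps\<close>.\<close>

lemma F_gen_fps_X:
  assumes P: "naturally_labeled_poset m P"
  shows "F_gen (fps_X :: int fps) m P =
    (\<Sum>j\<le>m. smult ((\<Prod>k = 1..m. qnum fps_X k) * ((- 1) ^ j * ideal_series m P j))
       ([:1, fps_X - 1:] ^ j))"
proof (rule poly_eqI_infinite)
  show "inj (qnum (fps_X :: int fps))"
  proof (rule inj_qnum, rule injI)
    fix a b assume "(fps_X :: int fps) ^ a = fps_X ^ b"
    then have "fps_nth ((fps_X :: int fps) ^ a) a = fps_nth (fps_X ^ b) a" by simp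
    then show "a = b" by (simp split: if_splits)
  qed
  fix n
  have "poly [:1, fps_X - 1:] (qnum (fps_X :: int fps) n) = fps_X ^ n"
    using one_minus_mult_qnum[of "fps_X :: int fps" n] by (simp add: algebra_simps)
  then show "poly (F_gen (fps_X :: int fps) m P) (qnum fps_X n) =
    poly (\<Sum>j\<le>m. smult ((\<Prod>k = 1..m. qnum fps_X k) * ((- 1) ^ j * ideal_series m P j))
       ([:1, fps_X - 1:] ^ j)) (qnum fps_X n)"
    unfolding poly_F_gen[OF P] ppartitions_series[OF P] poly_sum poly_smult poly_power sum_distrib_left
    by (simp only: mult_ac)
qed

section \<open>The lowest term for each ideal size\<close>

definition mc_list :: "nat \<Rightarrow> nat rel \<Rightarrow> nat list" where
  "mc_list m P = sort (map (mc P) [1..<m + 1])"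

text \<open>Sorts the elements themselves, so that its prefixes are available as ideals of minimal
  total \<open>mc\<close>.\<close>

definition mc_order :: "nat \<Rightarrow> nat rel \<Rightarrow> nat list" where
  "mc_order m P = sort_key (mc P) [1..<m + 1]"

definition mc_sum :: "nat \<Rightarrow> nat rel \<Rightarrow> nat \<Rightarrow> nat" where
  "mc_sum m P j = sum_list (take j (mc_list m P))"

context
  fixes m :: nat and P :: "nat rel"
  assumes P: "naturally_labeled_poset m P"
begin

abbreviation "chains_to x \<equiv> {T. T \<in> Chains P \<and> x \<in> T \<and> (\<forall>t\<in>T. (t, x) \<in> P)}"

lemma chains_to_subset:
  assumes "T \<in> chains_to x"
  shows "T \<subseteq> {1..m}"
proof
  fix t assume "t \<in> T"
  then have "(t, x) \<in> P" using assms by simp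
  then show "t \<in> {1..m}" by (rule poset_sub[OF P])
qed

lemma chains_to_finite:
  assumes "T \<in> chains_to x"
  shows "finite T"
  by (rule finite_subset[OF chains_to_subset[OF assms]]) simp

lemma mc_eq: "mc P x = Max (card ` chains_to x)"
proof -
  have "{card T | T. T \<in> Chains P \<and> x \<in> T \<and> (\<forall>t\<in>T. (t, x) \<in> P)} = card ` chains_to x"
    by blast
  then show ?thesis by (simp only: mc_def)
qed

lemma finite_card_chains: "finite (card ` chains_to x)"
proof (rule finite_imageI, rule finite_subset)
  show "chains_to x \<subseteq> Pow {1..m}"
    by (rule subsetI, rule PowI, rule chains_to_subset)
qed simp

lemma mc_ge: "T \<in> chains_to x \<Longrightarrow> card T \<le> mc P x"
  unfolding mc_eq by (rule Max_ge[OF finite_card_chains]) blast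

lemma mc_attained:
  assumes "x \<in> {1..m}"
  obtains T where "T \<in> chains_to x" "card T = mc P x"
proof -
  have "{x} \<in> chains_to x" using poset_refl[OF P assms] by (auto simp: Chains_def)
  then have "card ` chains_to x \<noteq> {}" by blast
  then have "mc P x \<in> card ` chains_to x"
    unfolding mc_eq by (rule Max_in[OF finite_card_chains])
  then show ?thesis using that by force
qed

lemma mc_pos:
  assumes "x \<in> {1..m}"
  shows "1 \<le> mc P x"
proof -
  have "{x} \<in> chains_to x" using poset_refl[OF P assms] by (auto simp: Chains_def)
  from mc_ge[OF this] show ?thesis by simp
qed

text \<open>A longest chain ending at x can be extended by y, which is not in it by
  antisymmetry.\<close>

lemma mc_strict:
  assumes "(x, y) \<in> P" "x \<noteq> y"
  shows "mc P x < mc P y"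
proof -
  have "x \<in> {1..m}" using poset_sub[OF P] assms by blast
  then obtain T where T: "T \<in> chains_to x" "card T = mc P x" by (rule mc_attained)
  have "y \<notin> T"
  proof
    assume "y \<in> T"
    then have "(y, x) \<in> P" using T(1) by blast
    then show False using poset_le[OF P assms(1)] poset_le[OF P, of y x] assms(2) by simp
  qed
  have below: "(t, y) \<in> P" if "t \<in> T" for t
    using T(1) that assms(1) poset_trans[OF P] by blast
  have "(y, y) \<in> P" using poset_refl[OF P] poset_sub(2)[OF P assms(1)] by blast
  then have "insert y T \<in> chains_to y"
    using T(1) below unfolding Chains_def by blast
  from mc_ge[OF this] show ?thesis
    using \<open>y \<notin> T\<close> T(2) chains_to_finite[OF T(1)] by simp
qed

text \<open>A longest chain ending at x stays inside the ideal, and z takes distinct positive values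
  up to z x along it.\<close>

lemma split_maps_ge_mc:
  assumes "I \<in> order_ideals m P" "z \<in> split_maps m P I 0" "x \<in> I"
  shows "mc P x \<le> z x"
proof -
  have "x \<in> {1..m}" using assms(1,3) by (auto simp: order_ideals_def)
  then obtain T where T: "T \<in> chains_to x" "card T = mc P x" by (rule mc_attained)
  have T_I: "t \<in> I" if "t \<in> T" for t
    using assms(1,3) T(1) that unfolding order_ideals_def by blast
  have strict: "z t < z u" if "(t, u) \<in> P" "t \<noteq> u" "t \<in> I" "u \<in> I" for t u
    using assms(2) that unfolding split_maps_def by blast
  have inj: "inj_on z T"
  proof (rule inj_onI, rule ccontr)
    fix t u assume tu: "t \<in> T" "u \<in> T" "z t = z u" "t \<noteq> u"
    then have "(t, u) \<in> P \<or> (u, t) \<in> P" using T(1) unfolding Chains_def by blast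
    then show False using strict[of t u] strict[of u t] tu T_I by auto
  qed
  have "z ` T \<subseteq> {1..z x}"
  proof
    fix k assume "k \<in> z ` T"
    then obtain t where t: "t \<in> T" "k = z t" by blast
    have "0 < z t" using assms(2) T_I[OF t(1)] by (simp add: split_maps_def)
    moreover have "z t \<le> z x"
      using strict[of t x] T(1) t(1) T_I assms(3) by (cases "t = x") auto
    ultimately show "k \<in> {1..z x}" using t by simp
  qed
  from card_mono[OF _ this] have "card T \<le> z x"
    by (simp add: card_image[OF inj])
  then show ?thesis using T(2) by simp
qed

lemma mc_list_eq: "mc_list m P = map (mc P) (mc_order m P)"
  unfolding mc_list_def mc_order_def
  by (rule properties_for_sort) simp_all

lemma length_mc [simp]: "length (mc_list m P) = m" "length (mc_order m P) = m"
  by (simp_all add: mc_list_def mc_order_def)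

lemma set_mc_order: "set (mc_order m P) = {1..m}"
  by (auto simp: mc_order_def)

lemma distinct_mc_order: "distinct (mc_order m P)"
  by (simp add: mc_order_def)

lemma mc_list_mono: "mono_on {..<m} ((!) (mc_list m P))"
  by (auto intro!: mono_onI sorted_nth_mono simp: mc_list_def)

lemma mc_sum_eq: "j \<le> m \<Longrightarrow> mc_sum m P j = (\<Sum>k<j. mc_list m P ! k)"
  by (simp add: mc_sum_def sum_list_sum_nth atLeast0LessThan)

lemma mc_list_pos: "k < m \<Longrightarrow> 1 \<le> mc_list m P ! k"
  using mc_pos[of "mc_order m P ! k"] nth_mem[of k "mc_order m P"] by (simp add: mc_list_eq set_mc_order)

text \<open>Each \<open>mc\<close> is at least 1. Strictness keeps the contribution of ideals larger
  than j above the lowest term at x^j.\<close>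

lemma mc_sum_less:
  assumes "j < k" "k \<le> m"
  shows "mc_sum m P j < mc_sum m P k"
  using assms
proof (induction k)
  case (Suc k)
  have "mc_sum m P (Suc k) = mc_sum m P k + mc_list m P ! k" using Suc.prems by (simp add: mc_sum_eq)
  then show ?case using Suc mc_list_pos[of k] by (cases "j = k") auto
qed simp

lemma mc_sum_le_sum_mc:
  assumes "K \<subseteq> {1..m}"
  shows "mc_sum m P (card K) \<le> (\<Sum>x\<in>K. mc P x)"
proof -
  \<comment> \<open>The positions of K in the sorted list: any card K positions carry at least the
    total of the first card K.\<close>
  define K' where "K' = {k. k < m \<and> mc_order m P ! k \<in> K}"
  have bij: "bij_betw ((!) (mc_order m P)) K' K"
    unfolding bij_betw_def
  proof
    show "inj_on ((!) (mc_order m P)) K'"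
      by (rule inj_onI) (simp add: K'_def nth_eq_iff_index_eq[OF distinct_mc_order])
    show "(!) (mc_order m P) ` K' = K"
    proof (intro equalityI subsetI)
      fix x assume "x \<in> K"
      then have "x \<in> set (mc_order m P)" using assms set_mc_order by blast
      then obtain k where "k < m" "mc_order m P ! k = x" by (auto simp: in_set_conv_nth)
      then show "x \<in> (!) (mc_order m P) ` K'" using \<open>x \<in> K\<close> by (auto simp: K'_def)
    qed (auto simp: K'_def)
  qed
  have card: "card K' = card K" by (rule bij_betw_same_card[OF bij])
  have "card K \<le> m" using card_mono[OF _ assms] by simp
  then have "mc_sum m P (card K) = (\<Sum>k<card K'. mc_list m P ! k)"
    by (simp add: mc_sum_eq card)
  also have "\<dots> \<le> (\<Sum>k\<in>K'. mc_list m P ! k)"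
    by (rule sum_initial_le[OF _ _ mc_list_mono]) (auto simp: K'_def)
  also have "\<dots> = (\<Sum>k\<in>K'. mc P (mc_order m P ! k))"
    by (rule sum.cong) (auto simp: mc_list_eq K'_def)
  also have "\<dots> = (\<Sum>x\<in>K. mc P x)"
    by (rule sum.reindex_bij_betw[OF bij])
  finally show ?thesis .
qed

lemma ideal_series_low:
  assumes "N < mc_sum m P j"
  shows "fps_nth (ideal_series m P j) N = 0"
proof -
  have empty: "{z \<in> split_maps m P I 0. (\<Sum>i = 1..m. z i) = N} = {}"
    if I: "I \<in> order_ideals m P" "card I = j" for I
  proof -
    have sub: "I \<subseteq> {1..m}" using I by (simp add: order_ideals_def)
    have "mc_sum m P j \<le> (\<Sum>i = 1..m. z i)" if z: "z \<in> split_maps m P I 0" for z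
    proof -
      have "mc_sum m P j \<le> (\<Sum>x\<in>I. mc P x)" using mc_sum_le_sum_mc[OF sub] I by simp
      also have "\<dots> \<le> (\<Sum>x\<in>I. z x)" by (rule sum_mono) (rule split_maps_ge_mc[OF I(1) z])
      also have "\<dots> \<le> (\<Sum>i = 1..m. z i)" by (rule sum_mono2) (use sub in auto)
      finally show ?thesis .
    qed
    then show ?thesis using assms by fastforce
  qed
  show ?thesis
    unfolding ideal_series_def fps_nth_Abs_fps
    by (intro sum.neutral ballI) (simp only: mem_Collect_eq empty card.empty of_nat_0)
qed

text \<open>Equality in \<open>ideal_series_low\<close> holds for the ideal of the first j elements
  of \<open>mc_order\<close> and the map that is \<open>mc\<close> on it and 0 elsewhere. All other
  counts are nonnegative, so the coefficient stays positive.\<close>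

lemma ideal_series_lowest:
  assumes "j \<le> m"
  shows "fps_nth (ideal_series m P j) (mc_sum m P j) > 0"
proof -
  define I where "I = set (take j (mc_order m P))"
  define z where "z = (\<lambda>i\<in>{1..m}. if i \<in> I then mc P i else 0)"
  have sub: "I \<subseteq> {1..m}" using set_take_subset[of j "mc_order m P"] by (simp add: I_def set_mc_order)
  have card: "card I = j"
    using assms distinct_card[OF distinct_take[OF distinct_mc_order, of j]] by (simp add: I_def)
  have "x \<in> I" if xy: "(x, y) \<in> P" "y \<in> I" for x y
  proof (cases "x = y")
    case False
    obtain k where k: "k < j" "k < m" "y = mc_order m P ! k"
      using xy(2) assms by (auto simp: I_def in_set_conv_nth)
    have "x \<in> set (mc_order m P)" using poset_sub(1)[OF P xy(1)] by (simp add: set_mc_order)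
    then obtain l where l: "l < m" "x = mc_order m P ! l" by (auto simp: in_set_conv_nth)
    \<comment> \<open>Since x has strictly smaller \<open>mc\<close> than y, it comes earlier in the
      list however ties are ordered, so the prefix is downward closed.\<close>
    have "mc_list m P ! l < mc_list m P ! k"
      using mc_strict[OF xy(1) False] k l by (simp add: mc_list_eq)
    then have "l < k"
      using mono_onD[OF mc_list_mono, of k l] k l by (meson leD leI lessThan_iff)
    then have "l < length (take j (mc_order m P))" "x = take j (mc_order m P) ! l" using k l by auto
    then show ?thesis unfolding I_def by (metis nth_mem)
  qed (use xy in simp)
  then have I: "I \<in> order_ideals m P" using sub unfolding order_ideals_def by blast
  have "z \<in> split_maps m P I 0"
  proof -
    have 1: "z \<in> {1..m} \<rightarrow>\<^sub>E UNIV" by (simp add: z_def)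
    have 2: "0 < z x" if "x \<in> I" for x
      using that sub mc_pos[of x] by (auto simp: z_def)
    have 3: "z x < z y" if "(x, y) \<in> P" "x \<noteq> y" "x \<in> I" "y \<in> I" for x y
      using mc_strict[OF that(1,2)] that(3,4) sub by (auto simp: z_def)
    have 4: "z y \<le> z x" if "(x, y) \<in> P" "x \<notin> I" "y \<notin> I" for x y
      using poset_sub[OF P that(1)] that by (simp add: z_def)
    show ?thesis using 1 2 3 4 unfolding split_maps_def by blast
  qed
  moreover have "(\<Sum>i = 1..m. z i) = mc_sum m P j"
  proof -
    have "(\<Sum>i = 1..m. z i) = (\<Sum>i\<in>I. mc P i)"
      by (rule sum.mono_neutral_cong_right) (use sub in \<open>auto simp: z_def\<close>)
    also have "\<dots> = sum_list (map (mc P) (take j (mc_order m P)))"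
      unfolding I_def by (rule sum.distinct_set_conv_list) (simp add: distinct_mc_order)
    finally show ?thesis by (simp add: mc_sum_def mc_list_eq take_map)
  qed
  ultimately have "{z \<in> split_maps m P I 0. (\<Sum>i = 1..m. z i) = mc_sum m P j} \<noteq> {}" by blast
  moreover have "finite {z \<in> split_maps m P I 0. (\<Sum>i = 1..m. z i) = mc_sum m P j}"
    by (rule finite_subset[OF _ finite_maps_with_sum[of m "mc_sum m P j"]]) (auto simp: split_maps_def)
  ultimately have "0 < card {z \<in> split_maps m P I 0. (\<Sum>i = 1..m. z i) = mc_sum m P j}"
    by (simp only: card_gt_0_iff simp_thms)
  then have pos: "0 < int (card {z \<in> split_maps m P I 0. (\<Sum>i = 1..m. z i) = mc_sum m P j})"
    by (simp only: of_nat_0_less_iff)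
  show ?thesis
    unfolding ideal_series_def fps_nth_Abs_fps
  proof (rule sum_pos2)
    show "finite {I. I \<in> order_ideals m P \<and> card I = j}"
      by (rule finite_subset[OF _ finite_order_ideals]) auto
    show "I \<in> {I. I \<in> order_ideals m P \<and> card I = j}" using I card by simp
  qed (use pos in simp_all)
qed

end

section \<open>The edges of the Newton polygon\<close>

lemma fps_mult_nth_low:
  assumes "\<And>i. i < N \<Longrightarrow> fps_nth g i = 0"
  shows "fps_nth (a * g) N = fps_nth a 0 * fps_nth (g :: 'a::comm_ring_1 fps) N"
proof -
  have "fps_nth (a * g) N = (\<Sum>i = 0..N. fps_nth a i * fps_nth g (N - i))"
    by (rule fps_mult_nth)
  also have "\<dots> = (\<Sum>i\<in>{0}. fps_nth a i * fps_nth g (N - i))"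
    by (rule sum.mono_neutral_right) (use assms in auto)
  finally show ?thesis by simp
qed

lemma ring_morphism_fps_nth_0: "ring_morphism (\<lambda>f :: int fps. fps_nth f 0)"
  by standard simp_all

lemma ring_morphism_fps_of_poly: "ring_morphism (fps_of_poly :: int poly \<Rightarrow> int fps)"
  by standard (simp_all add: fps_of_poly_add fps_of_poly_mult)

lemma qnum_zero: "qnum 0 (Suc k) = 1"
  by (induction k) (simp_all add: qnum_Suc)

text \<open>Moves the coefficients of F_P to \<open>int fps\<close>, where the expansion over ideals
  is available.\<close>

lemma coeff_F_poly:
  "coeff (coeff (F_poly m P) j) i = fps_nth (coeff (F_gen fps_X m P) j) i"
proof -
  have "F_gen fps_X m P = map_poly fps_of_poly (F_poly m P)"
    unfolding F_poly_eq ring_morphism.map_poly_F_gen[OF ring_morphism_fps_of_poly] by simp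
  then show ?thesis by (simp add: coeff_map_poly)
qed

lemma coeff_linear_power_high:
  assumes "k < j"
  shows "coeff ([:a, b :: 'a::comm_ring_1:] ^ k) j = 0"
proof (rule coeff_eq_0)
  have "degree ([:a, b:] ^ k) \<le> degree [:a, b:] * k" by (rule degree_power_le)
  also have "\<dots> \<le> 1 * k" by (rule mult_right_mono) simp_all
  finally show "degree ([:a, b:] ^ k) < j" using assms by simp
qed

lemma coeff_F_poly_high:
  assumes P: "naturally_labeled_poset m P" and "m < j"
  shows "coeff (coeff (F_poly m P) j) i = 0"
  unfolding coeff_F_poly F_gen_fps_X[OF P] coeff_sum coeff_smult
  using assms(2) by (simp add: coeff_linear_power_high)

text \<open>Only ideals of size j matter up to this exponent: y^k has x-degree below j for k < j,
  and the series for k > j starts beyond N. For k = j the cofactor M (-1)^j (q - 1)^j has constant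
  term 1, as [k] is 1 at q = 0 for k >= 1.\<close>

lemma coeff_F_poly_low:
  assumes P: "naturally_labeled_poset m P" and j: "j \<le> m" and N: "N \<le> mc_sum m P j"
  shows "coeff (coeff (F_poly m P) j) N = fps_nth (ideal_series m P j) N"
proof -
  define M :: "int fps" where "M = (\<Prod>k = 1..m. qnum fps_X k)"
  interpret nth0: ring_morphism "\<lambda>f :: int fps. fps_nth f 0"
    by (rule ring_morphism_fps_nth_0)
  have "fps_nth M 0 = (\<Prod>k = 1..m. qnum 0 k)"
    unfolding M_def nth0.h_prod nth0.h_qnum by simp
  also have "\<dots> = 1"
  proof (rule prod.neutral, rule ballI)
    fix k assume "k \<in> {1..m}"
    then show "qnum 0 k = (1 :: int)" by (cases k) (simp_all add: qnum_zero)
  qed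
  finally have M0: "fps_nth M 0 = 1" .
  have zero: "fps_nth (M * ((- 1) ^ k * ideal_series m P k) * coeff ([:1, fps_X - 1:] ^ k) j) N = 0"
    if "k \<le> m" "k \<noteq> j" for k
  proof (cases "k < j")
    case True
    then show ?thesis by (simp add: coeff_linear_power_high)
  next
    case False
    then have "N < mc_sum m P k" using mc_sum_less[OF P, of j k] that N by simp
    then have low: "fps_nth (ideal_series m P k) i = 0" if "i \<le> N" for i
      using ideal_series_low[OF P] that by simp
    have "fps_nth (M * (- 1) ^ k * coeff ([:1, fps_X - 1:] ^ k) j * ideal_series m P k) N = 0"
      by (subst fps_mult_nth_low) (use low in simp_all)
    then show ?thesis by (simp add: mult_ac)
  qed
  have main: "fps_nth (M * ((- 1) ^ j * ideal_series m P j) * coeff ([:1, fps_X - 1:] ^ j) j) N =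
      fps_nth (ideal_series m P j) N"
  proof -
    have c: "coeff ([:1, fps_X - 1:] ^ j) j = (fps_X - 1 :: int fps) ^ j"
      by (subst coeff_linear_poly_power) simp_all
    have "fps_nth (M * (- 1) ^ j * (fps_X - 1) ^ j) 0 = 1"
      unfolding nth0.h_mult nth0.h_power M0 by (simp flip: power_mult_distrib)
    then have "fps_nth (M * (- 1) ^ j * (fps_X - 1) ^ j * ideal_series m P j) N =
        fps_nth (ideal_series m P j) N"
      by (subst fps_mult_nth_low) (use ideal_series_low[OF P] N in simp_all)
    then show ?thesis unfolding c by (simp add: mult_ac)
  qed
  have "coeff (coeff (F_poly m P) j) N = (\<Sum>k\<le>m.
      fps_nth (M * ((- 1) ^ k * ideal_series m P k) * coeff ([:1, fps_X - 1:] ^ k) j) N)"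
    unfolding coeff_F_poly F_gen_fps_X[OF P] M_def coeff_sum coeff_smult fps_sum_nth ..
  also have "\<dots> = (\<Sum>k\<in>{j}.
      fps_nth (M * ((- 1) ^ k * ideal_series m P k) * coeff ([:1, fps_X - 1:] ^ k) j) N)"
    by (rule sum.mono_neutral_right) (use j zero in auto)
  finally show ?thesis using main by simp
qed

text \<open>Bounds q-exponent minus x-exponent on the support, that is, places it left of a line
  parallel to the right edge from (h - m, 0) to (h, m). The bound is an integer because the factor x
  alone has excess -1.\<close>

definition excess_le :: "int poly poly \<Rightarrow> int \<Rightarrow> bool" where
  "excess_le p B \<longleftrightarrow> (\<forall>i j. coeff (coeff p j) i \<noteq> 0 \<longrightarrow> int i \<le> B + int j)"

lemma excess_leD: "excess_le p B \<Longrightarrow> coeff (coeff p j) i \<noteq> 0 \<Longrightarrow> int i \<le> B + int j"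
  unfolding excess_le_def by blast

lemma excess_le_mult:
  assumes "excess_le p B" "excess_le r C"
  shows "excess_le (p * r) (B + C)"
  unfolding excess_le_def
proof (intro allI impI)
  fix i j assume "coeff (coeff (p * r) j) i \<noteq> 0"
  then have "(\<Sum>a\<le>j. coeff (coeff p a * coeff r (j - a)) i) \<noteq> 0"
    by (simp add: coeff_mult coeff_sum)
  then obtain a where a: "a \<le> j" "coeff (coeff p a * coeff r (j - a)) i \<noteq> 0"
    by (meson atMost_iff sum.not_neutral_contains_not_neutral)
  then have "(\<Sum>b\<le>i. coeff (coeff p a) b * coeff (coeff r (j - a)) (i - b)) \<noteq> 0"
    by (simp add: coeff_mult)
  then obtain b where b: "b \<le> i" "coeff (coeff p a) b * coeff (coeff r (j - a)) (i - b) \<noteq> 0"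
    by (meson atMost_iff sum.not_neutral_contains_not_neutral)
  then have "int b \<le> B + int a" "int (i - b) \<le> C + int (j - a)"
    by (auto intro: excess_leD[OF assms(1)] excess_leD[OF assms(2)] simp del: of_nat_diff)
  then show "int i \<le> B + C + int j" using a b by linarith
qed

lemma excess_le_prod:
  assumes "\<And>k. k \<in> A \<Longrightarrow> excess_le (p k) (B k)"
  shows "excess_le (\<Prod>k\<in>A. p k) (\<Sum>k\<in>A. B k)"
  using assms
  by (induction A rule: infinite_finite_induct)
    (auto simp: excess_le_mult, auto simp: excess_le_def coeff_1 split: if_splits)

lemma excess_le_pCons:
  assumes "\<And>i. coeff a i \<noteq> 0 \<Longrightarrow> int i \<le> B" "\<And>i. coeff b i \<noteq> 0 \<Longrightarrow> int i \<le> B + 1"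
  shows "excess_le [:a, b:] B"
  unfolding excess_le_def
proof (intro allI impI)
  fix i j assume "coeff (coeff [:a, b:] j) i \<noteq> 0"
  then show "int i \<le> B + int j"
    using assms by (auto simp: coeff_pCons split: nat.splits if_splits)
qed

lemma var_power: "[:0, 1 :: int:] ^ k = monom 1 k"
  by (simp add: monom_altdef)

lemma coeff_qnum: "coeff (qnum [:0, 1 :: int:] k) i = (if i < k then 1 else 0)"
  by (simp add: qnum_def coeff_sum var_power coeff_monom)

text \<open>Both kinds of linear factor have excess at most k - 1: [k] has degree k - 1, and q^k x
  has excess k - 1 as well.\<close>

lemma excess_le_pi_term:
  "excess_le (pi_term [:0, 1:] m s d)
     (int (s - \<Sum>{..<d}) + ((\<Sum>k<d. int k - 1) + (\<Sum>k = 1..m - d. int k - 1)))"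
proof -
  have neg: "excess_le [:- qnum [:0, 1:] k, 1:] (int k - 1)" for k
    by (rule excess_le_pCons) (auto simp: coeff_qnum coeff_1 split: if_splits)
  have pos: "excess_le [:qnum [:0, 1:] k, [:0, 1:] ^ k:] (int k - 1)" for k
    by (rule excess_le_pCons) (auto simp: coeff_qnum var_power split: if_splits)
  have scal: "excess_le [:[:0, 1:] ^ e:] (int e)" for e
    by (auto simp: excess_le_def var_power coeff_pCons split: nat.splits if_splits)
  have "pi_term [:0, 1:] m s d = [:[:0, 1:] ^ (s - \<Sum>{..<d}):] *
      ((\<Prod>k<d. [:- qnum [:0, 1 :: int:] k, 1:]) * (\<Prod>k = 1..m - d. [:qnum [:0, 1:] k, [:0, 1:] ^ k:]))"
    by (simp add: pi_term_def)
  then show ?thesis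
    by (simp only:) (intro excess_le_mult excess_le_prod scal neg pos)
qed

text \<open>Doubled and over \<open>int\<close>, to keep division and truncated subtraction out of
  the later algebra.\<close>

lemma triangle: "2 * int (\<Sum>{..<d}) = int d * (int d - 1)"
  by (induction d) (simp_all add: algebra_simps)

lemma choose_two_triangle: "2 * int ((m + 1) choose 2) = int m * (int m + 1)"
  by (induction m) (simp_all add: numeral_2_eq_2 algebra_simps)

text \<open>The sum 0 + ... + (d-1) extracted in \<open>pi_term\<close> cancels against the excess
  of the factors x - [k]. Inserting maj <= m d - d(d+1)/2 into the rest gives exactly m(m-1)/2 -
  d.\<close>

lemma excess_le_term:
  "excess_le (pi_term [:0, 1:] m (maj m \<pi>) (des m \<pi>))
     (int ((m + 1) choose 2) - int m - int (des m \<pi>))"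
proof -
  define d where "d = des m \<pi>"
  define s where "s = maj m \<pi>"
  have d: "d \<le> m" and s: "\<Sum>{..<d} \<le> s" and s_le: "s + \<Sum>{..<Suc d} \<le> m * d"
    unfolding d_def s_def by (rule des_le, rule maj_ge, rule maj_le)
  have "(\<Sum>k<d. int k - 1) = int (\<Sum>{..<d}) - int d"
    by (simp add: sum_subtractf)
  moreover have "2 * (\<Sum>k = 1..n. int k - 1) = int n * (int n - 1)" for n
    by (induction n) (simp_all add: algebra_simps)
  then have "2 * (\<Sum>k = 1..m - d. int k - 1) = (int m - int d) * (int m - int d - 1)"
    using d by (simp add: of_nat_diff)
  moreover have "2 * int s + int d * (int d + 1) \<le> 2 * (int m * int d)"
  proof -
    have "int s + int (\<Sum>{..<Suc d}) \<le> int m * int d"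
      using s_le by (metis of_nat_add of_nat_le_iff of_nat_mult)
    then show ?thesis using triangle[of "Suc d"] by (simp add: algebra_simps)
  qed
  moreover have "int (s - \<Sum>{..<d}) = int s - int (\<Sum>{..<d})" using s by (rule of_nat_diff)
  ultimately have "int (s - \<Sum>{..<d}) + ((\<Sum>k<d. int k - 1) + (\<Sum>k = 1..m - d. int k - 1)) \<le>
      int ((m + 1) choose 2) - int m - int d"
    using choose_two_triangle[of m] by (simp add: algebra_simps)
  then show ?thesis
    using excess_le_pi_term[of m s d] unfolding excess_le_def d_def s_def by force
qed

lemma coeff_F_poly_sum:
  "coeff (coeff (F_poly m P) j) i =
     (\<Sum>\<pi>\<in>linear_extensions m P. coeff (coeff (pi_term [:0, 1:] m (maj m \<pi>) (des m \<pi>)) j) i)"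
  by (simp add: F_poly_eq F_gen_def coeff_sum)

lemma coeff_F_poly_right:
  assumes "coeff (coeff (F_poly m P) j) i \<noteq> 0"
  shows "int i \<le> int ((m + 1) choose 2) - int m + int j"
proof -
  obtain \<pi> where "coeff (coeff (pi_term [:0, 1 :: int:] m (maj m \<pi>) (des m \<pi>)) j) i \<noteq> 0"
    using assms unfolding coeff_F_poly_sum by (meson sum.not_neutral_contains_not_neutral)
  then have "int i \<le> int ((m + 1) choose 2) - int m - int (des m \<pi>) + int j"
    by (rule excess_leD[OF excess_le_term])
  then show ?thesis by linarith
qed

section \<open>Support points on the right edge\<close>

lemma coeff_prod_linear:
  fixes a b :: "nat \<Rightarrow> 'a::comm_ring_1"
  shows "coeff (\<Prod>k = 1..n. [:a k, b k:]) n = (\<Prod>k = 1..n. b k)"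
    and "coeff (\<Prod>k = 1..n. [:a k, b k:]) 0 = (\<Prod>k = 1..n. a k)"
proof -
  have "degree (\<Prod>k = 1..n. [:a k, b k:]) \<le> n \<and>
      coeff (\<Prod>k = 1..n. [:a k, b k:]) n = (\<Prod>k = 1..n. b k)"
  proof (induction n)
    case (Suc n)
    let ?T = "\<Prod>k = 1..n. [:a k, b k:]"
    have eq: "(\<Prod>k = 1..Suc n. [:a k, b k:]) = ?T * [:a (Suc n), b (Suc n):]" by simp
    have "degree (?T * [:a (Suc n), b (Suc n):]) \<le> degree ?T + degree [:a (Suc n), b (Suc n):]"
      by (rule degree_mult_le)
    also have "\<dots> \<le> n + 1" using Suc by (intro add_mono) simp_all
    finally have "degree (?T * [:a (Suc n), b (Suc n):]) \<le> Suc n" by simp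
    moreover have "coeff ?T (Suc n) = 0" using Suc by (intro coeff_eq_0) simp
    then have "coeff (?T * [:a (Suc n), b (Suc n):]) (Suc n) = (\<Prod>k = 1..Suc n. b k)"
      using Suc by (simp add: mult_ac)
    ultimately show ?case unfolding eq by blast
  qed simp
  then show "coeff (\<Prod>k = 1..n. [:a k, b k:]) n = (\<Prod>k = 1..n. b k)" by blast
  show "coeff (\<Prod>k = 1..n. [:a k, b k:]) 0 = (\<Prod>k = 1..n. a k)"
    by (simp add: poly_prod flip: poly_0_coeff_0)
qed

lemma id_linear_extension:
  assumes "naturally_labeled_poset m P"
  shows "id \<in> linear_extensions m P" "des m id = 0"
  using assms by (simp_all add: linear_extensions_def naturally_labeled_poset_def permutes_id
      des_def descents_def)

lemma pi_term_no_descents: "pi_term q m s 0 = smult (q ^ s) (\<Prod>k = 1..m. [:qnum q k, q ^ k:])"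
  by (simp add: pi_term_def)

text \<open>On this line only extensions without descents contribute, and all of them contribute the
  same coefficient. The coefficient of F_P is thus a positive multiple of it, the identity being
  such an extension.\<close>

lemma coeff_F_poly_edge:
  assumes P: "naturally_labeled_poset m P"
    and edge: "int i = int ((m + 1) choose 2) - int m + int j"
    and c: "coeff (coeff (\<Prod>k = 1..m. [:qnum [:0, 1 :: int:] k, [:0, 1:] ^ k:]) j) i \<noteq> 0"
  shows "coeff (coeff (F_poly m P) j) i \<noteq> 0"
proof -
  let ?L = "linear_extensions m P"
  let ?c = "coeff (coeff (\<Prod>k = 1..m. [:qnum [:0, 1 :: int:] k, [:0, 1:] ^ k:]) j) i"
  have fin: "finite ?L"
    by (rule finite_subset[OF _ finite_permutations[of "{1..m}"]]) (auto simp: linear_extensions_def)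
  have contrib: "coeff (coeff (pi_term [:0, 1 :: int:] m (maj m \<pi>) (des m \<pi>)) j) i =
      ?c * of_bool (des m \<pi> = 0)" for \<pi>
  proof (cases "des m \<pi> = 0")
    case True
    then have "maj m \<pi> = 0" by (simp add: des_def maj_def finite_descents)
    then show ?thesis using True by (simp add: pi_term_no_descents)
  next
    case False
    have "coeff (coeff (pi_term [:0, 1 :: int:] m (maj m \<pi>) (des m \<pi>)) j) i = 0"
    proof (rule ccontr)
      assume "coeff (coeff (pi_term [:0, 1 :: int:] m (maj m \<pi>) (des m \<pi>)) j) i \<noteq> 0"
      then have "int i \<le> int ((m + 1) choose 2) - int m - int (des m \<pi>) + int j"
        by (rule excess_leD[OF excess_le_term])
      then show False using False edge by linarith
    qed
    then show ?thesis using False by simp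
  qed
  have "coeff (coeff (F_poly m P) j) i = ?c * (\<Sum>\<pi>\<in>?L. of_bool (des m \<pi> = 0))"
    unfolding coeff_F_poly_sum contrib sum_distrib_left ..
  moreover have "(\<Sum>\<pi>\<in>?L. of_bool (des m \<pi> = 0)) > (0 :: int)"
    by (rule sum_pos2[OF fin id_linear_extension(1)[OF P]]) (simp_all add: id_linear_extension(2)[OF P])
  ultimately show ?thesis using c by simp
qed

lemma choose_two_ge: "m \<le> (m + 1) choose 2"
  by (induction m) (simp_all add: numeral_2_eq_2)

text \<open>The x^m coefficient of the descent-free product is q^(1 + ... + m).\<close>

lemma coeff_F_poly_top:
  assumes P: "naturally_labeled_poset m P"
  shows "coeff (coeff (F_poly m P) m) ((m + 1) choose 2) \<noteq> 0"
proof (rule coeff_F_poly_edge[OF P])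
  have "(\<Prod>k = 1..m. [:0, 1 :: int:] ^ k) = [:0, 1:] ^ (\<Sum>k = 1..m. k)"
    by (rule power_sum[symmetric])
  also have "\<dots> = monom 1 (\<Sum>k = 1..m. k)"
    by (rule var_power)
  also have "(\<Sum>k = 1..m. k) = (m + 1) choose 2"
    by (induction m) (simp_all add: numeral_2_eq_2)
  finally show "coeff (coeff (\<Prod>k = 1..m. [:qnum [:0, 1 :: int:] k, [:0, 1:] ^ k:]) m)
      ((m + 1) choose 2) \<noteq> 0"
    unfolding coeff_prod_linear by simp
qed simp

text \<open>At x = 0 the descent-free product is [1]...[m], which is monic in q of degree 0 + 1 +
  ... + (m-1).\<close>

lemma coeff_F_poly_bottom:
  assumes P: "naturally_labeled_poset m P"
  shows "coeff (coeff (F_poly m P) 0) (((m + 1) choose 2) - m) \<noteq> 0"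
proof (rule coeff_F_poly_edge[OF P])
  show "int (((m + 1) choose 2) - m) = int ((m + 1) choose 2) - int m + int 0"
    using choose_two_ge[of m] by simp
  have deg: "degree (qnum [:0, 1 :: int:] k) = k - 1" if "1 \<le> k" for k
    by (rule antisym[OF degree_le le_degree]) (use that in \<open>auto simp: coeff_qnum\<close>)
  have "qnum [:0, 1 :: int:] k \<noteq> 0" if "1 \<le> k" for k
    using coeff_qnum[of k 0] that by auto
  then have "degree (\<Prod>k = 1..m. qnum [:0, 1 :: int:] k) = (\<Sum>k = 1..m. k - 1)"
    by (subst degree_prod_eq_sum_degree) (auto simp: deg)
  also have "(\<Sum>k = 1..m. k - 1) = ((m + 1) choose 2) - m"
  proof -
    have "(\<Sum>k = 1..m. k - 1) + m = (m + 1) choose 2"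
      by (induction m) (simp_all add: numeral_2_eq_2)
    then show ?thesis by linarith
  qed
  finally have "coeff (\<Prod>k = 1..m. qnum [:0, 1 :: int:] k) (((m + 1) choose 2) - m) =
      lead_coeff (\<Prod>k = 1..m. qnum [:0, 1 :: int:] k)"
    by (simp only:)
  also have "\<dots> = 1"
    unfolding lead_coeff_prod by (rule prod.neutral) (auto simp: deg coeff_qnum)
  finally show "coeff (coeff (\<Prod>k = 1..m. [:qnum [:0, 1 :: int:] k, [:0, 1:] ^ k:]) 0)
      (((m + 1) choose 2) - m) \<noteq> 0"
    unfolding coeff_prod_linear by simp
qed

section \<open>From the support to the polygon\<close>

lemma C_polygon_mc_list:
  "C_polygon (sort (map (mc P) [1..<m + 1])) h =
     convex hull ({(0, 0), (real h, real m), (real h - real m, 0)} \<union>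
       {(real (mc_sum m P i), real i) | i. 1 \<le> i \<and> i \<le> m})"
proof -
  have "length (sort (map (mc P) [1..<m + 1])) = m" by simp
  then show ?thesis unfolding C_polygon_def Let_def mc_sum_def mc_list_def by (simp only:)
qed

text \<open>The points generating C lie in the support, and every support point lies on a horizontal
  segment between the left boundary points and the right edge.\<close>

lemma newton_polygon_F_poly:
  assumes m: "1 \<le> m" and P: "naturally_labeled_poset m P"
  shows "newton_polygon (F_poly m P) =
    C_polygon (sort (map (mc P) [1..<m + 1])) ((m + 1) choose 2)"
proof -
  let ?h = "(m + 1) choose 2"
  define S where "S = {(real i, real j) | i j. coeff (coeff (F_poly m P) j) i \<noteq> 0}"
  define V where "V = {(0, 0), (real ?h, real m), (real ?h - real m, 0)} \<union>
       {(real (mc_sum m P i), real i) | i. 1 \<le> i \<and> i \<le> m}"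
  have left: "(real (mc_sum m P j), real j) \<in> S" if "j \<le> m" for j
  proof -
    have "coeff (coeff (F_poly m P) j) (mc_sum m P j) \<noteq> 0"
      using ideal_series_lowest[OF P that] by (simp add: coeff_F_poly_low[OF P that])
    then show ?thesis by (auto simp: S_def)
  qed
  have sum0: "mc_sum m P 0 = 0" by (simp add: mc_sum_def)
  have "(0, 0) \<in> S" using left[of 0] sum0 by simp
  moreover have "(real ?h, real m) \<in> S"
    using coeff_F_poly_top[OF P] unfolding S_def by blast
  moreover have "(real ?h - real m, 0) \<in> S"
  proof -
    have "(real (?h - m), real 0) \<in> S"
      using coeff_F_poly_bottom[OF P] unfolding S_def by blast
    then show ?thesis using choose_two_ge[of m] by (simp add: of_nat_diff)
  qed
  ultimately have "V \<subseteq> S" using left unfolding V_def by auto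
  moreover have "S \<subseteq> convex hull V"
  proof
    fix x assume "x \<in> S"
    then obtain i j where x: "x = (real i, real j)" and c: "coeff (coeff (F_poly m P) j) i \<noteq> 0"
      unfolding S_def by blast
    have j: "j \<le> m" using coeff_F_poly_high[OF P, of j i] c by force
    define a where "a = real (mc_sum m P j)"
    define b where "b = real ?h - real m + real j"
    have "mc_sum m P j \<le> i"
    proof (rule ccontr)
      assume "\<not> mc_sum m P j \<le> i"
      then show False
        using c coeff_F_poly_low[OF P j, of i] ideal_series_low[OF P, of i j] by simp
    qed
    then have ai: "a \<le> real i" by (simp add: a_def)
    have ib: "real i \<le> b"
    proof -
      have "real_of_int (int i) \<le> real_of_int (int ?h - int m + int j)"
        using coeff_F_poly_right[OF c] of_int_le_iff by blast
      then show ?thesis by (simp add: b_def)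
    qed
    have cv: "convex (convex hull V)" by simp
    have V_hull: "v \<in> convex hull V" if "v \<in> V" for v using that by (rule hull_inc)
    \<comment> \<open>For j = 0 this is the origin, which \<open>V\<close> lists separately.\<close>
    have A: "(a, real j) \<in> convex hull V"
      by (rule V_hull) (use j sum0 in \<open>cases "j = 0"; auto simp: V_def a_def\<close>)
    have B: "(b, real j) \<in> convex hull V"
    proof -
      have "(1 - real j / real m) *\<^sub>R (real ?h - real m, 0) + (real j / real m) *\<^sub>R (real ?h, real m)
          \<in> convex hull V"
        by (rule convexD_alt[OF cv V_hull V_hull]) (use j m in \<open>simp_all add: V_def\<close>)
      moreover have "(1 - real j / real m) *\<^sub>R (real ?h - real m, 0) +
          (real j / real m) *\<^sub>R (real ?h, real m) = (b, real j)"
        using m by (simp add: b_def field_simps)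
      ultimately show ?thesis by simp
    qed
    show "x \<in> convex hull V"
    \<comment> \<open>The segment can degenerate, for a chain at j = m for instance, and the weight
      below divides by b - a.\<close>
    proof (cases "a = b")
      case True
      then show ?thesis using A ai ib x by simp
    next
      case False
      then have ab: "a < b" using ai ib by simp
      let ?u = "(real i - a) / (b - a)"
      have "(1 - ?u) *\<^sub>R (a, real j) + ?u *\<^sub>R (b, real j) \<in> convex hull V"
        by (rule convexD_alt[OF cv A B]) (use ab ai ib in \<open>simp_all add: field_simps\<close>)
      moreover have "(1 - ?u) * a + ?u * b = real i"
      proof -
        have "(1 - u) * a + u * b = a + u * (b - a)" for u by (simp add: algebra_simps)
        then have "(1 - ?u) * a + ?u * b = a + ?u * (b - a)" .
        also have "?u * (b - a) = real i - a" using ab by simp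
        finally show ?thesis by simp
      qed
      moreover have "(1 - ?u) * real j + ?u * real j = real j" by (simp add: algebra_simps)
      ultimately show ?thesis using x by simp
    qed
  qed
  ultimately have "convex hull S = convex hull V"
    by (intro equalityI hull_minimal) (auto intro: hull_mono[THEN subsetD] hull_inc)
  then show ?thesis
    unfolding newton_polygon_def C_polygon_mc_list S_def V_def .
qed

theorem theorem2p5:
  fixes m :: nat and P :: "nat rel"
  assumes "m \<ge> 1"
    and "naturally_labeled_poset m P"
  shows "embed_qx (F_poly m P) = smult (qfact m) (q_Ehrhart m (P\<inverse>)) \<and>
         smult (qfact m) (q_Ehrhart m (P\<inverse>)) =
           (\<Sum>\<pi>\<in>linear_extensions m P.
              smult (qvar ^ maj m \<pi>)
                (\<Prod>i = 1..m. [: qint (int i - int (des m \<pi>)),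
                              qvar powi (int i - int (des m \<pi>)) :])) \<and>
         newton_polygon (F_poly m P) =
           C_polygon (sort (map (mc P) [1..<m + 1])) ((m + 1) choose 2)"
  using newton_polygon_F_poly[OF assms] q_Ehrhart_eq[OF assms(2)] embed_F_gen[of m P]
  by (simp only: F_poly_eq F_sum_def simp_thms)

end
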